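(* Let $(A,\cdot_A,[,]_A,\alpha_A,\beta_A)$ and $(B,\cdot_B,[,]_B,\alpha_B,\beta_B)$ be two regular BiHom-Poisson algebras over $K$. Define two bilinear operations $\cdot$ and $[,]$ on $A\otimes B$ by $$(a\otimes b)\cdot(a'\otimes b')=a\cdot_A a'\otimes b\cdot_B b',$$ $$[a\otimes b,a'\otimes b']=[a,a']_A\otimes b\cdot_B b'+a\cdot_A a'\otimes[b,b']_B,$$ for all $a,a'\in A$, $b,b'\in B$. Then $(A\otimes B,\cdot,[,],\alpha_A\otimes\alpha_B,\beta_A\otimes\beta_B)$ is a BiHom-Poisson algebra.
   Context: $K$ is a field of characteristic $0$; all vector spaces, tensor products and linear maps are over $K$. A BiHom-commutative algebra $(L,\cdot,\alpha,\beta)$ is a vector space $L$ with a bilinear product $\cdot$ and linear maps $\alpha,\beta:L\to L$ such that for all $x,y,z$: $\alpha\circ\beta=\beta\circ\alpha$, $\alpha(x\cdot y)=\alpha(x)\cdot\alpha(y)$, $\beta(x\cdot y)=\beta(x)\cdot\beta(y)$, $\alpha(x)\cdot(y\cdot z)=(x\cdot y)\cdot\beta(z)$, and $\beta(x)\cdot\alpha(y)=\beta(y)\cdot\alpha(x)$. A BiHom-Lie algebra $(L,[,],\alpha,\beta)$ is a vector space $L$ with a bilinear bracket and commuting linear maps $\alpha,\beta:L\to L$ such that for all $x,y,z$: $\alpha([x,y])=[\alpha(x),\alpha(y)]$, $\beta([x,y])=[\beta(x),\beta(y)]$, $[\beta(x),\alpha(y)]=-[\beta(y),\alpha(x)]$,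 and $[[\beta(x),\alpha(y)],\alpha^2(z)]+[[\beta(y),\alpha(z)],\alpha^2(x)]+[[\beta(z),\alpha(x)],\alpha^2(y)]=0$. A BiHom-Poisson algebra is a 5-tuple $(L,\cdot,[,],\alpha,\beta)$ such that $(L,\cdot,\alpha,\beta)$ is a BiHom-commutative algebra, $(L,[,],\alpha,\beta)$ is a BiHom-Lie algebra, and for all $x,y,z$: $[\alpha\beta(x),y\cdot z]=[\beta(x),y]\cdot\beta(z)+\beta(y)\cdot[\alpha(x),z]$. It is regular if $\alpha,\beta$ are invertible. *)

theory Defs
  imports "HOL-Algebra.Module" "HOL-Algebra.AbelCoset"
begin

text \<open>
  A vector space over a field \<open>K\<close> is a \<open>module K V\<close> with \<open>field K\<close>. The record type of modules
  extends that of rings, but \<open>module K V\<close> says nothing about the fields \<open>mult\<close> and \<open>one\<close> of \<open>V\<close>.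
  They are ignored throughout: products and brackets are separate parameters, and all
  conditions on them are relativised to the carriers.
\<close>

definition linear_map ::
    "('k, 'r) ring_scheme \<Rightarrow> ('k, 'v, 'm) module_scheme \<Rightarrow> ('k, 'w, 'n) module_scheme
      \<Rightarrow> ('v \<Rightarrow> 'w) \<Rightarrow> bool" where
  "linear_map K V W f \<longleftrightarrow>
     f \<in> carrier V \<rightarrow> carrier W \<and>
     (\<forall>x\<in>carrier V. \<forall>y\<in>carrier V. f (x \<oplus>\<^bsub>V\<^esub> y) = f x \<oplus>\<^bsub>W\<^esub> f y) \<and>
     (\<forall>c\<in>carrier K. \<forall>x\<in>carrier V. f (c \<odot>\<^bsub>V\<^esub> x) = c \<odot>\<^bsub>W\<^esub> f x)"

definition bilinear_map ::
    "('k, 'r) ring_scheme \<Rightarrow> ('k, 'u, 'l) module_scheme \<Rightarrow> ('k, 'v, 'm) module_scheme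
      \<Rightarrow> ('k, 'w, 'n) module_scheme \<Rightarrow> ('u \<Rightarrow> 'v \<Rightarrow> 'w) \<Rightarrow> bool" where
  "bilinear_map K U V W f \<longleftrightarrow>
     (\<forall>x\<in>carrier U. linear_map K V W (\<lambda>y. f x y)) \<and>
     (\<forall>y\<in>carrier V. linear_map K U W (\<lambda>x. f x y))"


section \<open>BiHom-algebras\<close>

locale bihom_commutative_algebra = field K + module K L
  for K :: "('k, 'r) ring_scheme" (structure) and L :: "('k, 'v, 'm) module_scheme" (structure) +
  fixes prd :: "'v \<Rightarrow> 'v \<Rightarrow> 'v" (infixl \<open>\<bullet>\<close> 70)
    and \<alpha> \<beta> :: "'v \<Rightarrow> 'v"
  assumes prd_bilinear: "bilinear_map K L L L (\<bullet>)"
    and \<alpha>_linear: "linear_map K L L \<alpha>"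
    and \<beta>_linear: "linear_map K L L \<beta>"
    and \<alpha>_\<beta>_commute: "x \<in> carrier L \<Longrightarrow> \<alpha> (\<beta> x) = \<beta> (\<alpha> x)"
    and \<alpha>_prd: "\<lbrakk>x \<in> carrier L; y \<in> carrier L\<rbrakk> \<Longrightarrow> \<alpha> (x \<bullet> y) = \<alpha> x \<bullet> \<alpha> y"
    and \<beta>_prd: "\<lbrakk>x \<in> carrier L; y \<in> carrier L\<rbrakk> \<Longrightarrow> \<beta> (x \<bullet> y) = \<beta> x \<bullet> \<beta> y"
    and bihom_assoc:
      "\<lbrakk>x \<in> carrier L; y \<in> carrier L; z \<in> carrier L\<rbrakk> \<Longrightarrow> \<alpha> x \<bullet> (y \<bullet> z) = (x \<bullet> y) \<bullet> \<beta> z"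
    and bihom_comm: "\<lbrakk>x \<in> carrier L; y \<in> carrier L\<rbrakk> \<Longrightarrow> \<beta> x \<bullet> \<alpha> y = \<beta> y \<bullet> \<alpha> x"

locale bihom_Lie_algebra = field K + module K L
  for K :: "('k, 'r) ring_scheme" (structure) and L :: "('k, 'v, 'm) module_scheme" (structure) +
  fixes br :: "'v \<Rightarrow> 'v \<Rightarrow> 'v"
    and \<alpha> \<beta> :: "'v \<Rightarrow> 'v"
  assumes br_bilinear: "bilinear_map K L L L br"
    and \<alpha>_linear: "linear_map K L L \<alpha>"
    and \<beta>_linear: "linear_map K L L \<beta>"
    and \<alpha>_\<beta>_commute: "x \<in> carrier L \<Longrightarrow> \<alpha> (\<beta> x) = \<beta> (\<alpha> x)"
    and \<alpha>_br: "\<lbrakk>x \<in> carrier L; y \<in> carrier L\<rbrakk> \<Longrightarrow> \<alpha> (br x y) = br (\<alpha> x) (\<alpha> y)"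
    and \<beta>_br: "\<lbrakk>x \<in> carrier L; y \<in> carrier L\<rbrakk> \<Longrightarrow> \<beta> (br x y) = br (\<beta> x) (\<beta> y)"
    and bihom_skew_symmetric:
      "\<lbrakk>x \<in> carrier L; y \<in> carrier L\<rbrakk> \<Longrightarrow> br (\<beta> x) (\<alpha> y) = \<ominus>\<^bsub>L\<^esub> br (\<beta> y) (\<alpha> x)"
    and bihom_Jacobi:
      "\<lbrakk>x \<in> carrier L; y \<in> carrier L; z \<in> carrier L\<rbrakk> \<Longrightarrow>
         br (br (\<beta> x) (\<alpha> y)) (\<alpha> (\<alpha> z)) \<oplus>\<^bsub>L\<^esub> br (br (\<beta> y) (\<alpha> z)) (\<alpha> (\<alpha> x))
           \<oplus>\<^bsub>L\<^esub> br (br (\<beta> z) (\<alpha> x)) (\<alpha> (\<alpha> y)) = \<zero>\<^bsub>L\<^esub>"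

locale bihom_Poisson_algebra =
  comm: bihom_commutative_algebra K L prd \<alpha> \<beta> + Lie: bihom_Lie_algebra K L br \<alpha> \<beta>
  for K :: "('k, 'r) ring_scheme" (structure) and L :: "('k, 'v, 'm) module_scheme" (structure)
    and prd :: "'v \<Rightarrow> 'v \<Rightarrow> 'v" (infixl \<open>\<bullet>\<close> 70)
    and br :: "'v \<Rightarrow> 'v \<Rightarrow> 'v"
    and \<alpha> \<beta> :: "'v \<Rightarrow> 'v" +
  assumes bihom_Leibniz:
    "\<lbrakk>x \<in> carrier L; y \<in> carrier L; z \<in> carrier L\<rbrakk> \<Longrightarrow>
       br (\<alpha> (\<beta> x)) (y \<bullet> z) = (br (\<beta> x) y \<bullet> \<beta> z) \<oplus>\<^bsub>L\<^esub> (\<beta> y \<bullet> br (\<alpha> x) z)"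

locale regular_bihom_Poisson_algebra = bihom_Poisson_algebra +
  assumes \<alpha>_invertible: "bij_betw \<alpha> (carrier L) (carrier L)"
    and \<beta>_invertible: "bij_betw \<beta> (carrier L) (carrier L)"


section \<open>The tensor product of two vector spaces\<close>

text \<open>
  The tensor product of \<open>A\<close> and \<open>B\<close> is the free vector space on \<open>carrier A \<times> carrier B\<close>, modulo
  the subspace generated by the bilinearity relations.
\<close>

definition free_space :: "('k, 'r) ring_scheme \<Rightarrow> 's set \<Rightarrow> ('k, 's \<Rightarrow> 'k) module" where
  "free_space K S =
     \<lparr>carrier = {f. (\<forall>s\<in>S. f s \<in> carrier K) \<and> (\<forall>s. s \<notin> S \<longrightarrow> f s = \<zero>\<^bsub>K\<^esub>) \<and>
                    finite {s. f s \<noteq> \<zero>\<^bsub>K\<^esub>}},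
      mult = undefined,
      one = undefined,
      zero = (\<lambda>_. \<zero>\<^bsub>K\<^esub>),
      add = (\<lambda>f g s. f s \<oplus>\<^bsub>K\<^esub> g s),
      smult = (\<lambda>c f s. c \<otimes>\<^bsub>K\<^esub> f s)\<rparr>"

definition free_gen :: "('k, 'r) ring_scheme \<Rightarrow> 's \<Rightarrow> 's \<Rightarrow> 'k" where
  "free_gen K s = (\<lambda>t. if t = s then \<one>\<^bsub>K\<^esub> else \<zero>\<^bsub>K\<^esub>)"

definition subspace_generated ::
    "('k, 'r) ring_scheme \<Rightarrow> ('k, 'v, 'm) module_scheme \<Rightarrow> 'v set \<Rightarrow> 'v set" where
  "subspace_generated K V S = \<Inter>{H. submodule H K V \<and> S \<subseteq> H}"

definition quotient_space ::
    "('k, 'r) ring_scheme \<Rightarrow> ('k, 'v, 'm) module_scheme \<Rightarrow> 'v set \<Rightarrow> ('k, 'v set) module" where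
  "quotient_space K V N =
     \<lparr>carrier = a_rcosets\<^bsub>V\<^esub> N,
      mult = undefined,
      one = undefined,
      zero = N,
      add = set_add V,
      smult = (\<lambda>c X. \<Union>x\<in>X. N +>\<^bsub>V\<^esub> (c \<odot>\<^bsub>V\<^esub> x))\<rparr>"

definition tensor_relations ::
    "('k, 'r) ring_scheme \<Rightarrow> ('k, 'a, 'm) module_scheme \<Rightarrow> ('k, 'b, 'n) module_scheme
      \<Rightarrow> ('a \<times> 'b \<Rightarrow> 'k) set" where
  "tensor_relations K A B =
     (let F = free_space K (carrier A \<times> carrier B); \<delta> = (\<lambda>a b. free_gen K (a, b)) in
       {\<delta> (a \<oplus>\<^bsub>A\<^esub> a') b \<ominus>\<^bsub>F\<^esub> (\<delta> a b \<oplus>\<^bsub>F\<^esub> \<delta> a' b) | a a' b.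
          a \<in> carrier A \<and> a' \<in> carrier A \<and> b \<in> carrier B}
     \<union> {\<delta> a (b \<oplus>\<^bsub>B\<^esub> b') \<ominus>\<^bsub>F\<^esub> (\<delta> a b \<oplus>\<^bsub>F\<^esub> \<delta> a b') | a b b'.
          a \<in> carrier A \<and> b \<in> carrier B \<and> b' \<in> carrier B}
     \<union> {\<delta> (c \<odot>\<^bsub>A\<^esub> a) b \<ominus>\<^bsub>F\<^esub> (c \<odot>\<^bsub>F\<^esub> \<delta> a b) | c a b.
          c \<in> carrier K \<and> a \<in> carrier A \<and> b \<in> carrier B}
     \<union> {\<delta> a (c \<odot>\<^bsub>B\<^esub> b) \<ominus>\<^bsub>F\<^esub> (c \<odot>\<^bsub>F\<^esub> \<delta> a b) | c a b.
          c \<in> carrier K \<and> a \<in> carrier A \<and> b \<in> carrier B})"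

definition tensor_null ::
    "('k, 'r) ring_scheme \<Rightarrow> ('k, 'a, 'm) module_scheme \<Rightarrow> ('k, 'b, 'n) module_scheme
      \<Rightarrow> ('a \<times> 'b \<Rightarrow> 'k) set" where
  "tensor_null K A B =
     subspace_generated K (free_space K (carrier A \<times> carrier B)) (tensor_relations K A B)"

definition tensor_space ::
    "('k, 'r) ring_scheme \<Rightarrow> ('k, 'a, 'm) module_scheme \<Rightarrow> ('k, 'b, 'n) module_scheme
      \<Rightarrow> ('k, ('a \<times> 'b \<Rightarrow> 'k) set) module" where
  "tensor_space K A B =
     quotient_space K (free_space K (carrier A \<times> carrier B)) (tensor_null K A B)"

definition pure_tensor ::
    "('k, 'r) ring_scheme \<Rightarrow> ('k, 'a, 'm) module_scheme \<Rightarrow> ('k, 'b, 'n) module_scheme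
      \<Rightarrow> 'a \<Rightarrow> 'b \<Rightarrow> ('a \<times> 'b \<Rightarrow> 'k) set" where
  "pure_tensor K A B a b =
     tensor_null K A B +>\<^bsub>free_space K (carrier A \<times> carrier B)\<^esub> free_gen K (a, b)"


section \<open>Operations on the tensor product\<close>

text \<open>
  Linear and bilinear maps out of \<open>A \<otimes> B\<close> are specified, as usual, by their values on pure
  tensors; the following predicates say that a map is linear or bilinear with the prescribed
  values; that there is such a map is not part of these definitions.
\<close>

definition is_tensor_map ::
    "('k, 'r) ring_scheme \<Rightarrow> ('k, 'a, 'm) module_scheme \<Rightarrow> ('k, 'b, 'n) module_scheme
      \<Rightarrow> ('a \<Rightarrow> 'a) \<Rightarrow> ('b \<Rightarrow> 'b)
      \<Rightarrow> (('a \<times> 'b \<Rightarrow> 'k) set \<Rightarrow> ('a \<times> 'b \<Rightarrow> 'k) set) \<Rightarrow> bool" where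
  "is_tensor_map K A B f g h \<longleftrightarrow>
     linear_map K (tensor_space K A B) (tensor_space K A B) h \<and>
     (\<forall>a\<in>carrier A. \<forall>b\<in>carrier B.
        h (pure_tensor K A B a b) = pure_tensor K A B (f a) (g b))"

definition is_tensor_product_op ::
    "('k, 'r) ring_scheme \<Rightarrow> ('k, 'a, 'm) module_scheme \<Rightarrow> ('k, 'b, 'n) module_scheme
      \<Rightarrow> ('a \<Rightarrow> 'a \<Rightarrow> 'a) \<Rightarrow> ('b \<Rightarrow> 'b \<Rightarrow> 'b)
      \<Rightarrow> (('a \<times> 'b \<Rightarrow> 'k) set \<Rightarrow> ('a \<times> 'b \<Rightarrow> 'k) set \<Rightarrow> ('a \<times> 'b \<Rightarrow> 'k) set) \<Rightarrow> bool" where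
  "is_tensor_product_op K A B prdA prdB prd \<longleftrightarrow>
     bilinear_map K (tensor_space K A B) (tensor_space K A B) (tensor_space K A B) prd \<and>
     (\<forall>a\<in>carrier A. \<forall>a'\<in>carrier A. \<forall>b\<in>carrier B. \<forall>b'\<in>carrier B.
        prd (pure_tensor K A B a b) (pure_tensor K A B a' b')
          = pure_tensor K A B (prdA a a') (prdB b b'))"

definition is_tensor_bracket_op ::
    "('k, 'r) ring_scheme \<Rightarrow> ('k, 'a, 'm) module_scheme \<Rightarrow> ('k, 'b, 'n) module_scheme
      \<Rightarrow> ('a \<Rightarrow> 'a \<Rightarrow> 'a) \<Rightarrow> ('a \<Rightarrow> 'a \<Rightarrow> 'a) \<Rightarrow> ('b \<Rightarrow> 'b \<Rightarrow> 'b) \<Rightarrow> ('b \<Rightarrow> 'b \<Rightarrow> 'b)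
      \<Rightarrow> (('a \<times> 'b \<Rightarrow> 'k) set \<Rightarrow> ('a \<times> 'b \<Rightarrow> 'k) set \<Rightarrow> ('a \<times> 'b \<Rightarrow> 'k) set) \<Rightarrow> bool" where
  "is_tensor_bracket_op K A B prdA brA prdB brB br \<longleftrightarrow>
     bilinear_map K (tensor_space K A B) (tensor_space K A B) (tensor_space K A B) br \<and>
     (\<forall>a\<in>carrier A. \<forall>a'\<in>carrier A. \<forall>b\<in>carrier B. \<forall>b'\<in>carrier B.
        br (pure_tensor K A B a b) (pure_tensor K A B a' b')
          = pure_tensor K A B (brA a a') (prdB b b')
            \<oplus>\<^bsub>tensor_space K A B\<^esub> pure_tensor K A B (prdA a a') (brB b b'))"

end

theory Submission
  imports Defs
begin

text \<open>
  Linear and bilinear maps with prescribed values on pure tensors exist by the universal property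
  of the tensor product (\<open>tensor_linear_lift\<close>, \<open>tensor_bilinear_lift\<close>), which is derived from the
  concrete construction as a quotient of a free space. Every axiom of a BiHom-Poisson algebra is an
  equation between expressions that are linear in each variable, so it suffices to verify it on
  pure tensors (\<open>tensor_linear_eqI\<close>, \<open>tensor_bilinear_eqI\<close>, \<open>tensor_trilinear_eqI\<close>).

  On pure tensors, the axioms of a BiHom-commutative algebra, the compatibility of the structure
  maps with the bracket and skew-symmetry hold factor by factor. The Leibniz and Jacobi identities
  mix products and brackets of the two factors, and here regularity enters: since \<open>\<alpha>\<close> and \<open>\<beta>\<close> are
  surjective, the twisted commutative and associative laws can be applied to arbitrary products.
  This gives twisted versions of \<open>x (y z) = y (x z)\<close> (\<open>prd_left_commute\<close>), of the cyclic symmetry of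
  \<open>x y z\<close> (\<open>prd_cyclic\<close>) and of \<open>[x y, z] = [y, z] x - [z, x] y\<close> (\<open>br_prd\<close>).

  The Leibniz identity then follows by regrouping. For the Jacobi identity, write \<open>J\<close> for the nested
  bracket, \<open>M\<close> for the triple product and \<open>D\<^sub>1, D\<^sub>2, D\<^sub>3\<close> for \<open>[x, y] z\<close>, \<open>[y, z] x\<close>, \<open>[z, x] y\<close>
  (all suitably twisted) in the first factor, and likewise with a prime in the second. The nested
  bracket of three pure tensors is
  \<open>J \<otimes> M' + D\<^sub>1 \<otimes> (D\<^sub>2' - D\<^sub>3') + (D\<^sub>2 - D\<^sub>3) \<otimes> D\<^sub>1' + M \<otimes> J'\<close>.
  With \<open>s\<^sub>i\<^sub>j = D\<^sub>i \<otimes> D\<^sub>j' + D\<^sub>j \<otimes> D\<^sub>i'\<close> the middle part is \<open>s\<^sub>1\<^sub>2 - s\<^sub>3\<^sub>1\<close>, and the cyclic sum of these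
  differences telescopes to zero. Because \<open>M\<close> and \<open>M'\<close> are invariant under cyclic permutations, the
  outer parts add up to the Jacobi sum of one factor tensored with \<open>M'\<close> or \<open>M\<close>, hence to zero.
\<close>


section \<open>Linear and bilinear maps\<close>

lemma linear_mapI:
  assumes "\<And>x. x \<in> carrier V \<Longrightarrow> f x \<in> carrier W"
    and "\<And>x y. \<lbrakk>x \<in> carrier V; y \<in> carrier V\<rbrakk> \<Longrightarrow> f (x \<oplus>\<^bsub>V\<^esub> y) = f x \<oplus>\<^bsub>W\<^esub> f y"
    and "\<And>c x. \<lbrakk>c \<in> carrier K; x \<in> carrier V\<rbrakk> \<Longrightarrow> f (c \<odot>\<^bsub>V\<^esub> x) = c \<odot>\<^bsub>W\<^esub> f x"
  shows "linear_map K V W f"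
  using assms by (simp add: linear_map_def)

lemma linear_mapD:
  assumes "linear_map K V W f"
  shows "x \<in> carrier V \<Longrightarrow> f x \<in> carrier W"
    and "\<lbrakk>x \<in> carrier V; y \<in> carrier V\<rbrakk> \<Longrightarrow> f (x \<oplus>\<^bsub>V\<^esub> y) = f x \<oplus>\<^bsub>W\<^esub> f y"
    and "\<lbrakk>c \<in> carrier K; x \<in> carrier V\<rbrakk> \<Longrightarrow> f (c \<odot>\<^bsub>V\<^esub> x) = c \<odot>\<^bsub>W\<^esub> f x"
  using assms by (auto simp: linear_map_def)

lemma bilinear_mapI:
  assumes "\<And>x. x \<in> carrier U \<Longrightarrow> linear_map K V W (f x)"
    and "\<And>y. y \<in> carrier V \<Longrightarrow> linear_map K U W (\<lambda>x. f x y)"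
  shows "bilinear_map K U V W f"
  using assms by (simp add: bilinear_map_def)

lemma bilinear_mapD:
  assumes "bilinear_map K U V W f"
  shows "x \<in> carrier U \<Longrightarrow> linear_map K V W (f x)"
    and "y \<in> carrier V \<Longrightarrow> linear_map K U W (\<lambda>x. f x y)"
  using assms by (auto simp: bilinear_map_def)

lemma bilinear_map_simps:
  assumes "bilinear_map K U V W f"
  shows "\<lbrakk>x \<in> carrier U; y \<in> carrier V\<rbrakk> \<Longrightarrow> f x y \<in> carrier W"
    and "\<lbrakk>x \<in> carrier U; x' \<in> carrier U; y \<in> carrier V\<rbrakk>
      \<Longrightarrow> f (x \<oplus>\<^bsub>U\<^esub> x') y = f x y \<oplus>\<^bsub>W\<^esub> f x' y"
    and "\<lbrakk>x \<in> carrier U; y \<in> carrier V; y' \<in> carrier V\<rbrakk>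
      \<Longrightarrow> f x (y \<oplus>\<^bsub>V\<^esub> y') = f x y \<oplus>\<^bsub>W\<^esub> f x y'"
    and "\<lbrakk>c \<in> carrier K; x \<in> carrier U; y \<in> carrier V\<rbrakk> \<Longrightarrow> f (c \<odot>\<^bsub>U\<^esub> x) y = c \<odot>\<^bsub>W\<^esub> f x y"
    and "\<lbrakk>c \<in> carrier K; x \<in> carrier U; y \<in> carrier V\<rbrakk> \<Longrightarrow> f x (c \<odot>\<^bsub>V\<^esub> y) = c \<odot>\<^bsub>W\<^esub> f x y"
  by (simp_all add: linear_mapD[OF bilinear_mapD(1)[OF assms]]
      linear_mapD[OF bilinear_mapD(2)[OF assms]])

lemma linear_map_uminus:
  assumes "linear_map K V W f" "module K V" "module K W" "x \<in> carrier V"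
  shows "f (\<ominus>\<^bsub>V\<^esub> x) = \<ominus>\<^bsub>W\<^esub> f x"
proof -
  interpret V: module K V by fact
  interpret W: module K W by fact
  have c: "\<ominus>\<^bsub>K\<^esub> \<one>\<^bsub>K\<^esub> \<in> carrier K" by simp
  have "f ((\<ominus>\<^bsub>K\<^esub> \<one>\<^bsub>K\<^esub>) \<odot>\<^bsub>V\<^esub> x) = (\<ominus>\<^bsub>K\<^esub> \<one>\<^bsub>K\<^esub>) \<odot>\<^bsub>W\<^esub> f x"
    using assms(4) by (intro linear_mapD(3)[OF assms(1)] c)
  then show ?thesis
    using assms by (simp add: V.smult_l_minus W.smult_l_minus linear_mapD(1)[OF assms(1)])
qed

lemma linear_map_compose:
  assumes "linear_map K V W f" "linear_map K U V g"
  shows "linear_map K U W (\<lambda>x. f (g x))"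
  using assms by (intro linear_mapI) (auto simp: linear_mapD)

lemma linear_map_add:
  assumes "module K W" "linear_map K V W f" "linear_map K V W g"
  shows "linear_map K V W (\<lambda>x. f x \<oplus>\<^bsub>W\<^esub> g x)"
proof -
  interpret W: module K W by fact
  show ?thesis
    using linear_mapD[OF assms(2)] linear_mapD[OF assms(3)]
    by (intro linear_mapI) (auto simp: W.smult_r_distr W.a_ac)
qed

lemma linear_map_uminus_fun:
  assumes "module K W" "linear_map K V W f"
  shows "linear_map K V W (\<lambda>x. \<ominus>\<^bsub>W\<^esub> f x)"
proof -
  interpret W: module K W by fact
  show ?thesis
    using linear_mapD[OF assms(2)]
    by (intro linear_mapI) (auto simp: W.smult_r_minus W.minus_add)
qed

lemma linear_map_smult:
  assumes "module K W" "c \<in> carrier K" "linear_map K V W f"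
  shows "linear_map K V W (\<lambda>x. c \<odot>\<^bsub>W\<^esub> f x)"
proof -
  interpret W: module K W by fact
  show ?thesis
    using linear_mapD[OF assms(3)] assms(2)
    by (intro linear_mapI)
      (auto simp: W.smult_r_distr W.smult_assoc1[symmetric] W.m_comm)
qed

lemma linear_map_zero:
  assumes "module K W"
  shows "linear_map K V W (\<lambda>_. \<zero>\<^bsub>W\<^esub>)"
proof -
  interpret W: module K W by fact
  show ?thesis by (intro linear_mapI) auto
qed

lemma linear_map_id: "linear_map K V V (\<lambda>x. x)"
  by (intro linear_mapI) auto

lemma bilinear_map_add:
  assumes "module K W" "bilinear_map K U V W f" "bilinear_map K U V W g"
  shows "bilinear_map K U V W (\<lambda>x y. f x y \<oplus>\<^bsub>W\<^esub> g x y)"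
  using assms(1) bilinear_mapD[OF assms(2)] bilinear_mapD[OF assms(3)]
  by (intro bilinear_mapI linear_map_add)

lemma bilinear_map_compose:
  assumes "bilinear_map K U' V' W f" "linear_map K U U' g" "linear_map K V V' h"
  shows "bilinear_map K U V W (\<lambda>x y. f (g x) (h y))"
proof (rule bilinear_mapI)
  fix x assume "x \<in> carrier U"
  then have "g x \<in> carrier U'"
    by (rule linear_mapD(1)[OF assms(2)])
  then show "linear_map K V W (\<lambda>y. f (g x) (h y))"
    by (rule linear_map_compose[OF bilinear_mapD(1)[OF assms(1)] assms(3)])
next
  fix y assume "y \<in> carrier V"
  then have "h y \<in> carrier V'"
    by (rule linear_mapD(1)[OF assms(3)])
  then show "linear_map K U W (\<lambda>x. f (g x) (h y))"
    by (rule linear_map_compose[OF bilinear_mapD(2)[OF assms(1)] assms(2)])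
qed

section \<open>The free vector space\<close>

lemma (in cring) free_space_simps:
  shows "f \<in> carrier (free_space R S) \<longleftrightarrow>
      (\<forall>s\<in>S. f s \<in> carrier R) \<and> (\<forall>s. s \<notin> S \<longrightarrow> f s = \<zero>) \<and> finite {s. f s \<noteq> \<zero>}"
    and "\<zero>\<^bsub>free_space R S\<^esub> = (\<lambda>_. \<zero>)"
    and "f \<oplus>\<^bsub>free_space R S\<^esub> g = (\<lambda>s. f s \<oplus> g s)"
    and "c \<odot>\<^bsub>free_space R S\<^esub> f = (\<lambda>s. c \<otimes> f s)"
  by (simp_all add: free_space_def)

lemma (in cring) free_space_apply_closed:
  assumes "f \<in> carrier (free_space R S)"
  shows "f s \<in> carrier R"
  using assms by (cases "s \<in> S") (auto simp: free_space_simps)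

lemma (in cring) free_space_module: "module R (free_space R S)"
proof (rule moduleI)
  have add: "(\<lambda>s. f s \<oplus> g s) \<in> carrier (free_space R S)"
    if "f \<in> carrier (free_space R S)" "g \<in> carrier (free_space R S)" for f g
  proof -
    have "finite ({s. f s \<noteq> \<zero>} \<union> {s. g s \<noteq> \<zero>})"
      using that by (simp add: free_space_simps)
    moreover have "{s. f s \<oplus> g s \<noteq> \<zero>} \<subseteq> {s. f s \<noteq> \<zero>} \<union> {s. g s \<noteq> \<zero>}"
      by auto
    ultimately show ?thesis
      using that by (auto simp: free_space_simps intro: finite_subset)
  qed
  have smult: "(\<lambda>s. c \<otimes> f s) \<in> carrier (free_space R S)"
    if "c \<in> carrier R" "f \<in> carrier (free_space R S)" for c f
  proof -
    have "{s. c \<otimes> f s \<noteq> \<zero>} \<subseteq> {s. f s \<noteq> \<zero>}"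
      using that by auto
    then show ?thesis
      using that by (auto simp: free_space_simps intro: finite_subset)
  qed
  note apply_closed = free_space_apply_closed
  show "abelian_group (free_space R S)"
  proof (rule abelian_groupI)
    fix f assume f: "f \<in> carrier (free_space R S)"
    have "(\<lambda>s. (\<ominus> \<one>) \<otimes> f s) \<oplus>\<^bsub>free_space R S\<^esub> f = \<zero>\<^bsub>free_space R S\<^esub>"
      using f by (simp add: free_space_simps(2,3) l_minus l_neg apply_closed)
    moreover have "(\<lambda>s. (\<ominus> \<one>) \<otimes> f s) \<in> carrier (free_space R S)"
      using f by (intro smult) auto
    ultimately show "\<exists>g\<in>carrier (free_space R S). g \<oplus>\<^bsub>free_space R S\<^esub> f = \<zero>\<^bsub>free_space R S\<^esub>"
      by blast
  next
    show "\<zero>\<^bsub>free_space R S\<^esub> \<in> carrier (free_space R S)"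
      by (simp add: free_space_simps)
  qed (simp_all add: free_space_simps(2,3) add a_ac apply_closed)
  show "cring R" by (rule is_cring)
  fix c f assume "c \<in> carrier R" "f \<in> carrier (free_space R S)"
  then show "c \<odot>\<^bsub>free_space R S\<^esub> f \<in> carrier (free_space R S)"
    by (simp add: free_space_simps(4) smult)
qed (simp_all add: free_space_simps(2-4) m_assoc l_distr r_distr free_space_apply_closed)


lemma (in cring) free_gen_closed: "s \<in> S \<Longrightarrow> free_gen R s \<in> carrier (free_space R S)"
  by (auto simp: free_space_simps free_gen_def)

text \<open>
  A function of finite support is a finite sum of multiples of generators; the induction removes
  one point of the support at a time.
\<close>

lemma (in cring) free_space_induct [consumes 1, case_names zero gen add]:
  assumes "f \<in> carrier (free_space R S)"
    and zero: "P \<zero>\<^bsub>free_space R S\<^esub>"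
    and gen: "\<And>c s. \<lbrakk>c \<in> carrier R; s \<in> S\<rbrakk> \<Longrightarrow> P (c \<odot>\<^bsub>free_space R S\<^esub> free_gen R s)"
    and add: "\<And>f g. \<lbrakk>f \<in> carrier (free_space R S); g \<in> carrier (free_space R S); P f; P g\<rbrakk>
      \<Longrightarrow> P (f \<oplus>\<^bsub>free_space R S\<^esub> g)"
  shows "P f"
proof -
  interpret F: module R "free_space R S" by (rule free_space_module)
  have "finite {s. f s \<noteq> \<zero>}"
    using assms(1) by (simp add: free_space_simps)
  then show ?thesis
    using assms(1)
  proof (induction "{s. f s \<noteq> \<zero>}" arbitrary: f rule: finite_induct)
    case empty
    then have "f = \<zero>\<^bsub>free_space R S\<^esub>"
      by (auto simp: free_space_simps)
    then show ?case using zero by simp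
  next
    case (insert s T)
    note f = insert.prems
    have s: "s \<in> S" "f s \<in> carrier R"
      using insert.hyps(4) f by (auto simp: free_space_simps)
    define g where "g = f(s := \<zero>)"
    have T: "T = {t. g t \<noteq> \<zero>}"
      using insert.hyps(2,4) by (auto simp: g_def)
    then have g: "g \<in> carrier (free_space R S)"
      using f insert.hyps(1) by (auto simp: free_space_simps g_def)
    have "f = g \<oplus>\<^bsub>free_space R S\<^esub> f s \<odot>\<^bsub>free_space R S\<^esub> free_gen R s"
      using f s by (auto simp: free_space_simps(2-4) g_def free_gen_def free_space_apply_closed)
    then show ?case
      using add[OF g F.smult_closed[OF s(2) free_gen_closed[OF s(1)]] insert.hyps(3)[OF T g] gen[OF s(2,1)]]
      by metis
  qed
qed

definition free_extension ::
    "('k, 'r) ring_scheme \<Rightarrow> ('k, 'w, 'm) module_scheme \<Rightarrow> ('s \<Rightarrow> 'w) \<Rightarrow> ('s \<Rightarrow> 'k) \<Rightarrow> 'w" where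
  "free_extension K W g f = (\<Oplus>\<^bsub>W\<^esub>s\<in>{s. f s \<noteq> \<zero>\<^bsub>K\<^esub>}. f s \<odot>\<^bsub>W\<^esub> g s)"

context module
begin

text \<open>
  The support of a sum of two functions depends on both of them, so additivity of the extension
  can only be read off from sums over a common finite set containing all the supports.
\<close>

lemma free_extension_superset:
  assumes g: "g \<in> S \<rightarrow> carrier M" and f: "f \<in> carrier (free_space R S)"
    and T: "finite T" "{s. f s \<noteq> \<zero>} \<subseteq> T" "T \<subseteq> S"
  shows "free_extension R M g f = (\<Oplus>\<^bsub>M\<^esub>s\<in>T. f s \<odot>\<^bsub>M\<^esub> g s)"
proof -
  have "f s \<odot>\<^bsub>M\<^esub> g s \<in> carrier M" "\<zero> \<odot>\<^bsub>M\<^esub> g s = \<zero>\<^bsub>M\<^esub>" if "s \<in> T" for s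
    using funcset_mem[OF g, of s] that T(3) free_space_apply_closed[OF f] by auto
  then show ?thesis
    unfolding free_extension_def using T
    by (intro M.add.finprod_mono_neutral_cong_left) auto
qed

lemma free_extension_linear:
  assumes g: "g \<in> S \<rightarrow> carrier M"
  shows "linear_map R (free_space R S) M (free_extension R M g)"
proof (rule linear_mapI)
  interpret F: module R "free_space R S" by (rule free_space_module)
  have fin: "finite {s. f s \<noteq> \<zero>}" and sub: "{s. f s \<noteq> \<zero>} \<subseteq> S"
    if "f \<in> carrier (free_space R S)" for f
    using that by (auto simp: free_space_simps)
  have terms: "(\<lambda>s. f s \<odot>\<^bsub>M\<^esub> g s) \<in> T \<rightarrow> carrier M"
    if "f \<in> carrier (free_space R S)" "T \<subseteq> S" for f T
    using that g free_space_apply_closed[OF that(1)] by (auto intro!: smult_closed)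
  have g_closed: "g s \<in> carrier M" if "s \<in> T" "T \<subseteq> S" for s T
    using that g by auto
  fix f assume f: "f \<in> carrier (free_space R S)"
  show "free_extension R M g f \<in> carrier M"
    unfolding free_extension_def using terms[OF f sub[OF f]] by (rule M.finsum_closed)
  show "free_extension R M g (c \<odot>\<^bsub>free_space R S\<^esub> f) = c \<odot>\<^bsub>M\<^esub> free_extension R M g f"
    if c: "c \<in> carrier R" for c
  proof -
    let ?T = "{s. f s \<noteq> \<zero>}"
    note [simp] = free_space_apply_closed[OF f]
    have "free_extension R M g (c \<odot>\<^bsub>free_space R S\<^esub> f)
        = (\<Oplus>\<^bsub>M\<^esub>s\<in>?T. (c \<odot>\<^bsub>free_space R S\<^esub> f) s \<odot>\<^bsub>M\<^esub> g s)"
      using c by (intro free_extension_superset[OF g F.smult_closed[OF c f] fin[OF f] _ sub[OF f]])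
        (auto simp: free_space_simps(4))
    also have "\<dots> = (\<Oplus>\<^bsub>M\<^esub>s\<in>?T. c \<odot>\<^bsub>M\<^esub> (f s \<odot>\<^bsub>M\<^esub> g s))"
      using c g_closed[OF _ sub[OF f]]
      by (intro M.finsum_cong') (simp_all add: free_space_simps(4) smult_assoc1)
    also have "\<dots> = c \<odot>\<^bsub>M\<^esub> (\<Oplus>\<^bsub>M\<^esub>s\<in>?T. f s \<odot>\<^bsub>M\<^esub> g s)"
      by (rule finsum_smult_ldistr[symmetric, OF fin[OF f] c terms[OF f sub[OF f]]])
    finally show ?thesis
      by (simp add: free_extension_def)
  qed
  show "free_extension R M g (f \<oplus>\<^bsub>free_space R S\<^esub> f')
      = free_extension R M g f \<oplus>\<^bsub>M\<^esub> free_extension R M g f'"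
    if f': "f' \<in> carrier (free_space R S)" for f'
  proof -
    let ?T = "{s. f s \<noteq> \<zero>} \<union> {s. f' s \<noteq> \<zero>}"
    note [simp] = free_space_apply_closed[OF f] free_space_apply_closed[OF f']
    have T: "finite ?T" "?T \<subseteq> S"
      using fin sub f f' by auto
    have "free_extension R M g (f \<oplus>\<^bsub>free_space R S\<^esub> f')
        = (\<Oplus>\<^bsub>M\<^esub>s\<in>?T. (f \<oplus>\<^bsub>free_space R S\<^esub> f') s \<odot>\<^bsub>M\<^esub> g s)"
      by (intro free_extension_superset[OF g F.a_closed[OF f f'] T(1) _ T(2)])
        (auto simp: free_space_simps(3))
    also have "\<dots> = (\<Oplus>\<^bsub>M\<^esub>s\<in>?T. f s \<odot>\<^bsub>M\<^esub> g s \<oplus>\<^bsub>M\<^esub> f' s \<odot>\<^bsub>M\<^esub> g s)"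
      using g_closed[OF _ T(2)]
      by (intro M.finsum_cong') (simp_all add: free_space_simps(3) smult_l_distr)
    also have "\<dots> = (\<Oplus>\<^bsub>M\<^esub>s\<in>?T. f s \<odot>\<^bsub>M\<^esub> g s) \<oplus>\<^bsub>M\<^esub> (\<Oplus>\<^bsub>M\<^esub>s\<in>?T. f' s \<odot>\<^bsub>M\<^esub> g s)"
      by (rule M.finsum_addf[OF terms[OF f T(2)] terms[OF f' T(2)]])
    also have "\<dots> = free_extension R M g f \<oplus>\<^bsub>M\<^esub> free_extension R M g f'"
      using free_extension_superset[OF g f T(1) _ T(2)] free_extension_superset[OF g f' T(1) _ T(2)]
      by simp
    finally show ?thesis .
  qed
qed

lemma free_extension_gen:
  assumes g: "g \<in> S \<rightarrow> carrier M" and s: "s \<in> S"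
  shows "free_extension R M g (free_gen R s) = g s"
proof -
  have "free_extension R M g (free_gen R s) = (\<Oplus>\<^bsub>M\<^esub>t\<in>{s}. free_gen R s t \<odot>\<^bsub>M\<^esub> g t)"
    using s by (intro free_extension_superset[OF g free_gen_closed]) (auto simp: free_gen_def)
  also have "\<dots> = g s"
    using g s by (auto simp: free_gen_def Pi_def)
  finally show ?thesis .
qed

end

section \<open>Quotient spaces\<close>

lemma (in module) subspace_generated_incl: "S \<subseteq> subspace_generated R M S"
  by (auto simp: subspace_generated_def)

lemma (in module) subspace_generated_least:
  assumes "submodule H R M" "S \<subseteq> H"
  shows "subspace_generated R M S \<subseteq> H"
  using assms by (auto simp: subspace_generated_def)

lemma (in module) subspace_generated_submodule:
  assumes "S \<subseteq> carrier M"
  shows "submodule (subspace_generated R M S) R M"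
proof (rule submoduleI)
  show "subspace_generated R M S \<subseteq> carrier M"
    using carrier_is_submodule assms by (rule subspace_generated_least)
  show "\<zero>\<^bsub>M\<^esub> \<in> subspace_generated R M S"
    using subgroup.one_closed[OF submodule.axioms(1)]
    by (fastforce simp: subspace_generated_def)
qed (auto simp: subspace_generated_def submoduleE)

lemma linear_map_kernel_submodule:
  assumes f: "linear_map K V W f" and "module K V" "module K W"
  shows "submodule {x \<in> carrier V. f x = \<zero>\<^bsub>W\<^esub>} K V"
proof -
  interpret V: module K V by fact
  interpret W: module K W by fact
  note f_simps = linear_mapD[OF f] linear_map_uminus[OF f assms(2,3)]
  show ?thesis
  proof (rule V.submoduleI)
    have "f (\<zero>\<^bsub>K\<^esub> \<odot>\<^bsub>V\<^esub> \<zero>\<^bsub>V\<^esub>) = \<zero>\<^bsub>K\<^esub> \<odot>\<^bsub>W\<^esub> f \<zero>\<^bsub>V\<^esub>"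
      by (rule f_simps(3)) auto
    then show "\<zero>\<^bsub>V\<^esub> \<in> {x \<in> carrier V. f x = \<zero>\<^bsub>W\<^esub>}"
      by (simp add: f_simps(1))
  qed (auto simp: f_simps)
qed

locale quotient_module = module R M + submodule N R M
  for R :: "('k, 'r) ring_scheme" (structure) and M :: "('k, 'v, 'm) module_scheme" (structure)
    and N
begin

sublocale abelian_subgroup N M
  by (intro abelian_subgroupI3 additive_subgroup.intro submodule.axioms(1)[OF submodule_axioms]
      M.abelian_group_axioms)

lemma quotient_space_simps:
  shows "carrier (quotient_space R M N) = a_rcosets\<^bsub>M\<^esub> N"
    and "\<zero>\<^bsub>quotient_space R M N\<^esub> = N"
    and "X \<oplus>\<^bsub>quotient_space R M N\<^esub> Y = X <+>\<^bsub>M\<^esub> Y"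
    and "c \<odot>\<^bsub>quotient_space R M N\<^esub> X = (\<Union>x\<in>X. N +>\<^bsub>M\<^esub> (c \<odot>\<^bsub>M\<^esub> x))"
  by (simp_all add: quotient_space_def)

lemma quotient_cosetE:
  assumes "X \<in> carrier (quotient_space R M N)"
  obtains x where "x \<in> carrier M" "X = N +>\<^bsub>M\<^esub> x"
  using assms by (auto simp: quotient_space_simps A_RCOSETS_def')

lemma coset_closed: "x \<in> carrier M \<Longrightarrow> N +>\<^bsub>M\<^esub> x \<in> carrier (quotient_space R M N)"
  by (auto simp: quotient_space_simps A_RCOSETS_def')

lemma coset_eq_iff:
  assumes "x \<in> carrier M" "y \<in> carrier M"
  shows "N +>\<^bsub>M\<^esub> x = N +>\<^bsub>M\<^esub> y \<longleftrightarrow> x \<ominus>\<^bsub>M\<^esub> y \<in> N"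
proof -
  have "N +>\<^bsub>M\<^esub> x = N +>\<^bsub>M\<^esub> y \<longleftrightarrow> x \<in> N +>\<^bsub>M\<^esub> y"
    using a_repr_independence'[OF _ assms(2)] a_repr_independenceD[OF assms(1)] by auto
  then show ?thesis
    using a_rcos_module[OF assms(2,1)] by (simp add: a_minus_def)
qed

lemma coset_add:
  assumes "x \<in> carrier M" "y \<in> carrier M"
  shows "(N +>\<^bsub>M\<^esub> x) \<oplus>\<^bsub>quotient_space R M N\<^esub> (N +>\<^bsub>M\<^esub> y) = N +>\<^bsub>M\<^esub> (x \<oplus>\<^bsub>M\<^esub> y)"
  using assms by (simp add: quotient_space_simps a_rcos_sum)

text \<open>
  The scalar multiple of a coset is a union of cosets of \<open>N\<close>, one for each representative; these
  agree because \<open>N\<close> absorbs scalars.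
\<close>

lemma coset_smult:
  assumes c: "c \<in> carrier R" and x: "x \<in> carrier M"
  shows "c \<odot>\<^bsub>quotient_space R M N\<^esub> (N +>\<^bsub>M\<^esub> x) = N +>\<^bsub>M\<^esub> (c \<odot>\<^bsub>M\<^esub> x)"
proof -
  have "N +>\<^bsub>M\<^esub> (c \<odot>\<^bsub>M\<^esub> y) = N +>\<^bsub>M\<^esub> (c \<odot>\<^bsub>M\<^esub> x)" if "y \<in> N +>\<^bsub>M\<^esub> x" for y
  proof -
    have y: "y \<in> carrier M"
      using a_elemrcos_carrier that x by blast
    have "c \<odot>\<^bsub>M\<^esub> (y \<ominus>\<^bsub>M\<^esub> x) \<in> N"
      using a_rcos_module[OF x y] that c
      by (simp add: a_minus_def submodule.smult_closed[OF submodule_axioms])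
    then show ?thesis
      using c x y by (simp add: coset_eq_iff a_minus_def smult_r_distr smult_r_minus)
  qed
  then show ?thesis
    unfolding quotient_space_simps by (intro UN_constant_eq[OF a_rcos_self[OF x]]) simp
qed

lemma quotient_zero: "\<zero>\<^bsub>quotient_space R M N\<^esub> = N +>\<^bsub>M\<^esub> \<zero>\<^bsub>M\<^esub>"
  using a_subset by (simp add: quotient_space_simps)

lemma quotient_space_module: "module R (quotient_space R M N)"
proof (rule moduleI)
  show "cring R" by (rule R.is_cring)
  show "abelian_group (quotient_space R M N)"
  proof (rule abelian_groupI)
    fix X assume "X \<in> carrier (quotient_space R M N)"
    then obtain x where x: "x \<in> carrier M" "X = N +>\<^bsub>M\<^esub> x"
      by (rule quotient_cosetE)
    have "(N +>\<^bsub>M\<^esub> (\<ominus>\<^bsub>M\<^esub> x)) \<oplus>\<^bsub>quotient_space R M N\<^esub> X = \<zero>\<^bsub>quotient_space R M N\<^esub>"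
      using x by (simp add: coset_add M.l_neg quotient_zero del: a_coset_add_zero)
    then show "\<exists>Y\<in>carrier (quotient_space R M N).
        Y \<oplus>\<^bsub>quotient_space R M N\<^esub> X = \<zero>\<^bsub>quotient_space R M N\<^esub>"
      using coset_closed[of "\<ominus>\<^bsub>M\<^esub> x"] x(1) by auto
  next
    show "\<zero>\<^bsub>quotient_space R M N\<^esub> \<in> carrier (quotient_space R M N)"
      by (simp add: quotient_zero coset_closed del: a_coset_add_zero)
  qed (auto elim!: quotient_cosetE simp: coset_add coset_closed quotient_zero M.a_ac
      simp del: a_coset_add_zero)
qed (auto elim!: quotient_cosetE
    simp: coset_add coset_smult coset_closed smult_l_distr smult_r_distr smult_assoc1)

text \<open>
  A linear map that vanishes on \<open>N\<close> is constant on every coset, and its constant value is the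
  value of the induced map.
\<close>

lemma quotient_linear_lift:
  assumes f: "linear_map R M W f" and "module R W" and null: "\<And>x. x \<in> N \<Longrightarrow> f x = \<zero>\<^bsub>W\<^esub>"
  shows "\<exists>h. linear_map R (quotient_space R M N) W h \<and> (\<forall>x\<in>carrier M. h (N +>\<^bsub>M\<^esub> x) = f x)"
proof -
  interpret W: module R W by fact
  note f_simps = linear_mapD[OF f]
  have const: "f y = f x" if x: "x \<in> carrier M" and y: "y \<in> N +>\<^bsub>M\<^esub> x" for x y
  proof -
    obtain n where n: "n \<in> N" "y = n \<oplus>\<^bsub>M\<^esub> x"
      using y by (auto simp: a_r_coset_def')
    then show ?thesis
      using x null f_simps a_subset by auto
  qed
  define h where "h X = the_elem (f ` X)" for X
  have h: "h (N +>\<^bsub>M\<^esub> x) = f x" if "x \<in> carrier M" for x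
  proof -
    have "f ` (N +>\<^bsub>M\<^esub> x) = (\<lambda>_. f x) ` (N +>\<^bsub>M\<^esub> x)"
      by (rule image_cong[OF refl const[OF that]])
    also have "\<dots> = {f x}"
      by (rule image_constant[OF a_rcos_self[OF that]])
    finally have "f ` (N +>\<^bsub>M\<^esub> x) = {f x}" .
    then show ?thesis
      by (simp add: h_def)
  qed
  moreover have "linear_map R (quotient_space R M N) W h"
    by (rule linear_mapI) (auto elim!: quotient_cosetE simp: coset_add coset_smult h f_simps)
  ultimately show ?thesis by blast
qed

end

section \<open>The universal property of the tensor product\<close>

locale tensor_factors = A: module K A + B: module K B
  for K :: "('k, 'r) ring_scheme" and A :: "('k, 'a, 'm) module_scheme"
    and B :: "('k, 'b, 'n) module_scheme"
begin

abbreviation "FS \<equiv> free_space K (carrier A \<times> carrier B)"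
abbreviation "T \<equiv> tensor_space K A B"
abbreviation "tens \<equiv> pure_tensor K A B"

sublocale F: module K FS
  by (rule A.free_space_module)

lemma free_gen_pair_closed:
  "\<lbrakk>a \<in> carrier A; b \<in> carrier B\<rbrakk> \<Longrightarrow> free_gen K (a, b) \<in> carrier FS"
  by (simp add: A.free_gen_closed)

lemma tensor_relations_closed: "tensor_relations K A B \<subseteq> carrier FS"
  by (auto simp: tensor_relations_def Let_def
      intro!: F.minus_closed F.a_closed F.smult_closed free_gen_pair_closed)

sublocale Q: quotient_module K FS "tensor_null K A B"
  rewrites "quotient_space K FS (tensor_null K A B) = T"
proof -
  show "quotient_module K FS (tensor_null K A B)"
    unfolding tensor_null_def
    by (intro quotient_module.intro F.subspace_generated_submodule tensor_relations_closed
        F.module_axioms)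
qed (simp add: tensor_space_def)

lemma tensor_space_module: "module K T"
  by (rule Q.quotient_space_module)

sublocale T: module K T
  by (rule tensor_space_module)

lemma relation_null: "x \<in> tensor_relations K A B \<Longrightarrow> x \<in> tensor_null K A B"
  unfolding tensor_null_def using F.subspace_generated_incl by blast

lemma pure_tensor_bilinear: "bilinear_map K A B T tens"
proof (intro bilinear_mapI linear_mapI)
  fix a a' b assume ab: "a \<in> carrier A" "a' \<in> carrier A" "b \<in> carrier B"
  have "free_gen K (a \<oplus>\<^bsub>A\<^esub> a', b) \<ominus>\<^bsub>FS\<^esub> (free_gen K (a, b) \<oplus>\<^bsub>FS\<^esub> free_gen K (a', b))
      \<in> tensor_null K A B"
    using ab by (intro relation_null) (auto simp: tensor_relations_def Let_def)
  then show "tens (a \<oplus>\<^bsub>A\<^esub> a') b = tens a b \<oplus>\<^bsub>T\<^esub> tens a' b"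
    using ab by (simp add: pure_tensor_def Q.coset_add Q.coset_eq_iff free_gen_pair_closed)
next
  fix a b b' assume ab: "a \<in> carrier A" "b \<in> carrier B" "b' \<in> carrier B"
  have "free_gen K (a, b \<oplus>\<^bsub>B\<^esub> b') \<ominus>\<^bsub>FS\<^esub> (free_gen K (a, b) \<oplus>\<^bsub>FS\<^esub> free_gen K (a, b'))
      \<in> tensor_null K A B"
    using ab by (intro relation_null) (auto simp: tensor_relations_def Let_def)
  then show "tens a (b \<oplus>\<^bsub>B\<^esub> b') = tens a b \<oplus>\<^bsub>T\<^esub> tens a b'"
    using ab by (simp add: pure_tensor_def Q.coset_add Q.coset_eq_iff free_gen_pair_closed)
next
  fix c a b assume ab: "c \<in> carrier K" "a \<in> carrier A" "b \<in> carrier B"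
  have "free_gen K (c \<odot>\<^bsub>A\<^esub> a, b) \<ominus>\<^bsub>FS\<^esub> (c \<odot>\<^bsub>FS\<^esub> free_gen K (a, b)) \<in> tensor_null K A B"
    using ab by (intro relation_null) (auto simp: tensor_relations_def Let_def)
  then show "tens (c \<odot>\<^bsub>A\<^esub> a) b = c \<odot>\<^bsub>T\<^esub> tens a b"
    using ab by (simp add: pure_tensor_def Q.coset_smult Q.coset_eq_iff free_gen_pair_closed)
  have "free_gen K (a, c \<odot>\<^bsub>B\<^esub> b) \<ominus>\<^bsub>FS\<^esub> (c \<odot>\<^bsub>FS\<^esub> free_gen K (a, b)) \<in> tensor_null K A B"
    using ab by (intro relation_null) (auto simp: tensor_relations_def Let_def)
  then show "tens a (c \<odot>\<^bsub>B\<^esub> b) = c \<odot>\<^bsub>T\<^esub> tens a b"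
    using ab by (simp add: pure_tensor_def Q.coset_smult Q.coset_eq_iff free_gen_pair_closed)
qed (simp_all add: pure_tensor_def Q.coset_closed free_gen_pair_closed)

lemmas tens_simps = bilinear_map_simps[OF pure_tensor_bilinear]

text \<open>
  Sums of pure tensors exhaust the tensor product: scalars can be absorbed into the first factor,
  and zero is itself pure.
\<close>

lemma tensor_induct [consumes 1, case_names pure add]:
  assumes x: "x \<in> carrier T"
    and pure: "\<And>a b. \<lbrakk>a \<in> carrier A; b \<in> carrier B\<rbrakk> \<Longrightarrow> P (tens a b)"
    and add: "\<And>x y. \<lbrakk>x \<in> carrier T; y \<in> carrier T; P x; P y\<rbrakk> \<Longrightarrow> P (x \<oplus>\<^bsub>T\<^esub> y)"
  shows "P x"
proof -
  obtain f where f: "f \<in> carrier FS" "x = tensor_null K A B +>\<^bsub>FS\<^esub> f"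
    using x by (rule Q.quotient_cosetE)
  have scaled_gen: "P (tensor_null K A B +>\<^bsub>FS\<^esub> (c \<odot>\<^bsub>FS\<^esub> free_gen K s))"
    if c: "c \<in> carrier K" and s: "s \<in> carrier A \<times> carrier B" for c s
  proof -
    obtain a b where ab: "s = (a, b)" "a \<in> carrier A" "b \<in> carrier B"
      using s by auto
    have "tensor_null K A B +>\<^bsub>FS\<^esub> (c \<odot>\<^bsub>FS\<^esub> free_gen K s) = c \<odot>\<^bsub>T\<^esub> tens a b"
      using ab c by (simp add: pure_tensor_def Q.coset_smult free_gen_pair_closed)
    also have "\<dots> = tens (c \<odot>\<^bsub>A\<^esub> a) b"
      using ab c by (simp add: tens_simps)
    finally show ?thesis
      using pure[of "c \<odot>\<^bsub>A\<^esub> a" b] ab c by simp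
  qed
  have "P \<zero>\<^bsub>T\<^esub>"
  proof -
    have "tens \<zero>\<^bsub>A\<^esub> \<zero>\<^bsub>B\<^esub> = \<zero>\<^bsub>K\<^esub> \<odot>\<^bsub>T\<^esub> tens \<zero>\<^bsub>A\<^esub> \<zero>\<^bsub>B\<^esub>"
      using tens_simps(4)[of "\<zero>\<^bsub>K\<^esub>" "\<zero>\<^bsub>A\<^esub>" "\<zero>\<^bsub>B\<^esub>"] by simp
    also have "\<dots> = \<zero>\<^bsub>T\<^esub>"
      by (simp add: tens_simps)
    finally show ?thesis
      using pure[of "\<zero>\<^bsub>A\<^esub>" "\<zero>\<^bsub>B\<^esub>"] by simp
  qed
  have "P (tensor_null K A B +>\<^bsub>FS\<^esub> f)"
    using f(1)
  proof (induction rule: A.free_space_induct)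
    case zero
    show ?case
      using \<open>P \<zero>\<^bsub>T\<^esub>\<close> unfolding Q.quotient_zero .
  next
    case (gen c s)
    then show ?case by (rule scaled_gen)
  next
    case (add f g)
    then show ?case
      using assms(3)[OF Q.coset_closed Q.coset_closed] by (simp add: Q.coset_add)
  qed
  then show ?thesis
    using f(2) by simp
qed

lemma tensor_linear_eqI:
  assumes f: "linear_map K T W f" and g: "linear_map K T W g"
    and pure: "\<And>a b. \<lbrakk>a \<in> carrier A; b \<in> carrier B\<rbrakk> \<Longrightarrow> f (tens a b) = g (tens a b)"
    and x: "x \<in> carrier T"
  shows "f x = g x"
  using x by (induction rule: tensor_induct) (simp_all add: pure linear_mapD[OF f] linear_mapD[OF g])

lemma tensor_bilinear_eqI:
  assumes f: "bilinear_map K T T W f" and g: "bilinear_map K T T W g"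
    and pure: "\<And>a a' b b'. \<lbrakk>a \<in> carrier A; a' \<in> carrier A; b \<in> carrier B; b' \<in> carrier B\<rbrakk>
      \<Longrightarrow> f (tens a b) (tens a' b') = g (tens a b) (tens a' b')"
    and x: "x \<in> carrier T" and y: "y \<in> carrier T"
  shows "f x y = g x y"
proof (rule tensor_linear_eqI[OF bilinear_mapD(2)[OF f y] bilinear_mapD(2)[OF g y] _ x])
  fix a b assume ab: "a \<in> carrier A" "b \<in> carrier B"
  then have t: "tens a b \<in> carrier T"
    by (rule tens_simps)
  show "f (tens a b) y = g (tens a b) y"
    by (rule tensor_linear_eqI[OF bilinear_mapD(1)[OF f t] bilinear_mapD(1)[OF g t] _ y])
      (rule pure[OF ab(1) _ ab(2)])
qed

lemma tensor_trilinear_eqI: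
  assumes f: "\<And>x. x \<in> carrier T \<Longrightarrow> bilinear_map K T T W (f x)"
      "\<And>y z. \<lbrakk>y \<in> carrier T; z \<in> carrier T\<rbrakk> \<Longrightarrow> linear_map K T W (\<lambda>x. f x y z)"
    and g: "\<And>x. x \<in> carrier T \<Longrightarrow> bilinear_map K T T W (g x)"
      "\<And>y z. \<lbrakk>y \<in> carrier T; z \<in> carrier T\<rbrakk> \<Longrightarrow> linear_map K T W (\<lambda>x. g x y z)"
    and pure: "\<And>a b c a' b' c'. \<lbrakk>a \<in> carrier A; b \<in> carrier A; c \<in> carrier A;
        a' \<in> carrier B; b' \<in> carrier B; c' \<in> carrier B\<rbrakk>
      \<Longrightarrow> f (tens a a') (tens b b') (tens c c') = g (tens a a') (tens b b') (tens c c')"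
    and x: "x \<in> carrier T" and y: "y \<in> carrier T" and z: "z \<in> carrier T"
  shows "f x y z = g x y z"
proof (rule tensor_linear_eqI[OF f(2)[OF y z] g(2)[OF y z] _ x])
  fix a a' assume aa': "a \<in> carrier A" "a' \<in> carrier B"
  then have t: "tens a a' \<in> carrier T"
    by (rule tens_simps)
  show "f (tens a a') y z = g (tens a a') y z"
    by (rule tensor_bilinear_eqI[OF f(1)[OF t] g(1)[OF t] _ y z])
      (rule pure[OF aa'(1) _ _ aa'(2)])
qed

text \<open>
  Extend \<open>f\<close> linearly to the free space. Bilinearity of \<open>f\<close> says precisely that the extension
  kills the defining relations, so the kernel, being a subspace, contains everything they generate
  and the extension descends to the quotient.
\<close>

lemma tensor_linear_lift:
  assumes "module K W" and f: "bilinear_map K A B W f"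
  shows "\<exists>h. linear_map K T W h \<and> (\<forall>a\<in>carrier A. \<forall>b\<in>carrier B. h (tens a b) = f a b)"
proof -
  interpret W: module K W by fact
  note f_simps = bilinear_map_simps[OF f]
  define g where "g = free_extension K W (\<lambda>(a, b). f a b)"
  have closed: "(\<lambda>(a, b). f a b) \<in> carrier A \<times> carrier B \<rightarrow> carrier W"
    using f_simps(1) by auto
  have g: "linear_map K FS W g"
    unfolding g_def using closed by (rule W.free_extension_linear)
  note g_simps = linear_mapD[OF g] linear_map_uminus[OF g F.module_axioms W.module_axioms]
  have gen: "g (free_gen K (a, b)) = f a b" if "a \<in> carrier A" "b \<in> carrier B" for a b
    using W.free_extension_gen[OF closed, of "(a, b)"] that by (simp add: g_def)
  have "tensor_relations K A B \<subseteq> {x \<in> carrier FS. g x = \<zero>\<^bsub>W\<^esub>}"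
    using tensor_relations_closed
    by (auto simp: tensor_relations_def Let_def F.minus_eq g_simps gen f_simps
        free_gen_pair_closed W.M.r_neg)
  then have "tensor_null K A B \<subseteq> {x \<in> carrier FS. g x = \<zero>\<^bsub>W\<^esub>}"
    unfolding tensor_null_def
    by (intro F.subspace_generated_least linear_map_kernel_submodule[OF g F.module_axioms W.module_axioms])
  then obtain h where h: "linear_map K T W h"
    "\<And>x. x \<in> carrier FS \<Longrightarrow> h (tensor_null K A B +>\<^bsub>FS\<^esub> x) = g x"
    using Q.quotient_linear_lift[OF g W.module_axioms] by blast
  have "h (tens a b) = f a b" if "a \<in> carrier A" "b \<in> carrier B" for a b
    using that by (simp add: pure_tensor_def h(2) gen free_gen_pair_closed)
  then show ?thesis
    using h(1) by blast
qed

text \<open>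
  The universal property is applied twice, once in each operand. Fixing \<open>a\<close> and \<open>b\<close> gives linear
  maps \<open>h a b\<close> on the tensor product. For each \<open>y\<close> the map \<open>(a, b) \<mapsto> h a b y\<close> is again bilinear,
  because linear maps are determined by their values on pure tensors; lifting it gives \<open>g y\<close>.
  The same uniqueness shows that \<open>g y x\<close> is linear in \<open>y\<close>, so no space of linear maps has to be
  constructed.
\<close>

lemma tensor_bilinear_lift:
  assumes W: "module K W"
    and right: "\<And>a b. \<lbrakk>a \<in> carrier A; b \<in> carrier B\<rbrakk> \<Longrightarrow> bilinear_map K A B W (f a b)"
    and left: "\<And>a' b'. \<lbrakk>a' \<in> carrier A; b' \<in> carrier B\<rbrakk>
      \<Longrightarrow> bilinear_map K A B W (\<lambda>a b. f a b a' b')"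
  shows "\<exists>h. bilinear_map K T T W h \<and>
    (\<forall>a\<in>carrier A. \<forall>a'\<in>carrier A. \<forall>b\<in>carrier B. \<forall>b'\<in>carrier B.
       h (tens a b) (tens a' b') = f a b a' b')"
proof -
  define h where "h a b = (SOME h. linear_map K T W h \<and>
      (\<forall>a'\<in>carrier A. \<forall>b'\<in>carrier B. h (tens a' b') = f a b a' b'))" for a b
  have "linear_map K T W (h a b) \<and>
      (\<forall>a'\<in>carrier A. \<forall>b'\<in>carrier B. h a b (tens a' b') = f a b a' b')"
    if "a \<in> carrier A" "b \<in> carrier B" for a b
    unfolding h_def by (rule someI_ex[OF tensor_linear_lift[OF W right[OF that]]])
  then have h_linear: "\<And>a b. \<lbrakk>a \<in> carrier A; b \<in> carrier B\<rbrakk> \<Longrightarrow> linear_map K T W (h a b)"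
    and h: "\<And>a b a' b'. \<lbrakk>a \<in> carrier A; b \<in> carrier B; a' \<in> carrier A; b' \<in> carrier B\<rbrakk>
      \<Longrightarrow> h a b (tens a' b') = f a b a' b'"
    by blast+
  have h_bilinear: "bilinear_map K A B W (\<lambda>a b. h a b y)" if y: "y \<in> carrier T" for y
  proof (intro bilinear_mapI linear_mapI)
    fix a a' b assume ab: "a \<in> carrier A" "a' \<in> carrier A" "b \<in> carrier B"
    show "h (a \<oplus>\<^bsub>A\<^esub> a') b y = h a b y \<oplus>\<^bsub>W\<^esub> h a' b y"
      by (rule tensor_linear_eqI[OF h_linear linear_map_add[OF W h_linear h_linear] _ y])
        (simp_all add: ab h bilinear_map_simps(2)[OF left])
  next
    fix a b b' assume ab: "a \<in> carrier A" "b \<in> carrier B" "b' \<in> carrier B"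
    show "h a (b \<oplus>\<^bsub>B\<^esub> b') y = h a b y \<oplus>\<^bsub>W\<^esub> h a b' y"
      by (rule tensor_linear_eqI[OF h_linear linear_map_add[OF W h_linear h_linear] _ y])
        (simp_all add: ab h bilinear_map_simps(3)[OF left])
  next
    fix c a b assume ab: "c \<in> carrier K" "a \<in> carrier A" "b \<in> carrier B"
    show "h (c \<odot>\<^bsub>A\<^esub> a) b y = c \<odot>\<^bsub>W\<^esub> h a b y"
      by (rule tensor_linear_eqI[OF h_linear linear_map_smult[OF W ab(1) h_linear] _ y])
        (simp_all add: ab h bilinear_map_simps(4)[OF left])
    show "h a (c \<odot>\<^bsub>B\<^esub> b) y = c \<odot>\<^bsub>W\<^esub> h a b y"
      by (rule tensor_linear_eqI[OF h_linear linear_map_smult[OF W ab(1) h_linear] _ y])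
        (simp_all add: ab h bilinear_map_simps(5)[OF left])
  qed (simp_all add: y linear_mapD(1)[OF h_linear])
  define g where "g y = (SOME g. linear_map K T W g \<and>
      (\<forall>a\<in>carrier A. \<forall>b\<in>carrier B. g (tens a b) = h a b y))" for y
  have "linear_map K T W (g y) \<and>
      (\<forall>a\<in>carrier A. \<forall>b\<in>carrier B. g y (tens a b) = h a b y)" if "y \<in> carrier T" for y
    unfolding g_def by (rule someI_ex[OF tensor_linear_lift[OF W h_bilinear[OF that]]])
  then have g_linear: "\<And>y. y \<in> carrier T \<Longrightarrow> linear_map K T W (g y)"
    and g: "\<And>y a b. \<lbrakk>y \<in> carrier T; a \<in> carrier A; b \<in> carrier B\<rbrakk> \<Longrightarrow> g y (tens a b) = h a b y"
    by blast+
  have "bilinear_map K T T W (\<lambda>x y. g y x)"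
  proof (intro bilinear_mapI g_linear)
    fix x assume x: "x \<in> carrier T"
    show "linear_map K T W (\<lambda>y. g y x)"
    proof (rule linear_mapI)
      fix y y' assume y: "y \<in> carrier T" "y' \<in> carrier T"
      show "g (y \<oplus>\<^bsub>T\<^esub> y') x = g y x \<oplus>\<^bsub>W\<^esub> g y' x"
        by (rule tensor_linear_eqI[OF g_linear linear_map_add[OF W g_linear g_linear] _ x])
          (simp_all add: y g linear_mapD(2)[OF h_linear])
    next
      fix c y assume y: "c \<in> carrier K" "y \<in> carrier T"
      show "g (c \<odot>\<^bsub>T\<^esub> y) x = c \<odot>\<^bsub>W\<^esub> g y x"
        by (rule tensor_linear_eqI[OF g_linear linear_map_smult[OF W y(1) g_linear] _ x])
          (simp_all add: y g linear_mapD(3)[OF h_linear])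
    qed (rule linear_mapD(1)[OF g_linear x])
  qed
  moreover have "g (tens a' b') (tens a b) = f a b a' b'"
    if "a \<in> carrier A" "b \<in> carrier B" "a' \<in> carrier A" "b' \<in> carrier B" for a b a' b'
    using that by (simp add: g h tens_simps)
  ultimately show ?thesis by blast
qed

lemma tensor_map_exists:
  assumes "linear_map K A A f" "linear_map K B B g"
  shows "\<exists>h. is_tensor_map K A B f g h"
  unfolding is_tensor_map_def
  by (rule tensor_linear_lift[OF tensor_space_module
        bilinear_map_compose[OF pure_tensor_bilinear assms]])

lemma tensor_product_op_exists:
  assumes f: "bilinear_map K A A A f" and g: "bilinear_map K B B B g"
  shows "\<exists>h. is_tensor_product_op K A B f g h"
  unfolding is_tensor_product_op_def
  by (rule tensor_bilinear_lift[where f = "\<lambda>a b a' b'. tens (f a a') (g b b')"];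
      (intro tensor_space_module bilinear_map_compose[OF pure_tensor_bilinear]
        bilinear_mapD[OF f] bilinear_mapD[OF g])?)

text \<open>
  The bracket is a sum of two operations, each of which is a product of one operation on \<open>A\<close> and
  one on \<open>B\<close>.
\<close>

lemma tensor_bracket_op_exists:
  assumes "bilinear_map K A A A prdA" "bilinear_map K A A A brA"
    and "bilinear_map K B B B prdB" "bilinear_map K B B B brB"
  shows "\<exists>br. is_tensor_bracket_op K A B prdA brA prdB brB br"
proof -
  obtain h h' where "is_tensor_product_op K A B brA prdB h" "is_tensor_product_op K A B prdA brB h'"
    using tensor_product_op_exists assms by blast
  then show ?thesis
    by (intro exI[where x = "\<lambda>x y. h x y \<oplus>\<^bsub>T\<^esub> h' x y"])
      (simp add: is_tensor_bracket_op_def is_tensor_product_op_def bilinear_map_add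
        tensor_space_module)
qed

end


section \<open>Identities in regular BiHom-Poisson algebras\<close>

context bihom_Poisson_algebra
begin

lemmas operations_closed =
  linear_mapD(1)[OF comm.\<alpha>_linear] linear_mapD(1)[OF comm.\<beta>_linear]
  bilinear_map_simps(1)[OF comm.prd_bilinear] bilinear_map_simps(1)[OF Lie.br_bilinear]

lemma prd_uminus_left:
  assumes "x \<in> carrier L" "y \<in> carrier L"
  shows "(\<ominus>\<^bsub>L\<^esub> x) \<bullet> y = \<ominus>\<^bsub>L\<^esub> (x \<bullet> y)"
  using linear_map_uminus[OF bilinear_mapD(2)[OF comm.prd_bilinear assms(2)]
      comm.module_axioms comm.module_axioms assms(1)] .

end

context regular_bihom_Poisson_algebra
begin

lemma \<alpha>_surj:
  assumes "x \<in> carrier L"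
  obtains y where "y \<in> carrier L" "x = \<alpha> y"
  using assms \<alpha>_invertible by (auto simp: bij_betw_def)

lemma \<beta>_surj:
  assumes "x \<in> carrier L"
  obtains y where "y \<in> carrier L" "x = \<beta> y"
  using assms \<beta>_invertible by (auto simp: bij_betw_def)

text \<open>
  In an ordinary commutative algebra this is \<open>x (y z) = y (x z)\<close>. Twisted commutativity only
  applies to products of the form \<open>\<beta> x \<bullet> \<alpha> y\<close>; surjectivity of \<open>\<alpha>\<close> brings the product into that
  form.
\<close>

lemma prd_left_commute:
  assumes "x \<in> carrier L" "y \<in> carrier L" "z \<in> carrier L"
  shows "\<alpha> (\<beta> x) \<bullet> (y \<bullet> z) = \<beta> y \<bullet> (\<alpha> x \<bullet> z)"
proof -
  obtain w where w: "w \<in> carrier L" "y = \<alpha> w"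
    using assms(2) by (rule \<alpha>_surj)
  note [simp] = operations_closed assms w(1)
  have "\<alpha> (\<beta> x) \<bullet> (y \<bullet> z) = (\<beta> x \<bullet> \<alpha> w) \<bullet> \<beta> z"
    using w(2) comm.bihom_assoc[of "\<beta> x" y z] by simp
  also have "\<dots> = (\<beta> w \<bullet> \<alpha> x) \<bullet> \<beta> z"
    using comm.bihom_comm[of x w] by simp
  also have "\<dots> = \<alpha> (\<beta> w) \<bullet> (\<alpha> x \<bullet> z)"
    using comm.bihom_assoc[of "\<beta> w" "\<alpha> x" z] by simp
  also have "\<dots> = \<beta> y \<bullet> (\<alpha> x \<bullet> z)"
    using w(2) comm.\<alpha>_\<beta>_commute[of w] by simp
  finally show ?thesis .
qed

text \<open>
  The twisted form of the symmetry of \<open>x y z\<close> under cyclic permutations. It lets the Jacobi sums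
  of the two factors be collected against a common product in the other factor. Associativity needs
  the last operand \<open>\<alpha> (\<alpha> z)\<close> to be a value of \<open>\<beta>\<close>, which surjectivity of \<open>\<beta>\<close> provides.
\<close>

lemma prd_cyclic:
  assumes "x \<in> carrier L" "y \<in> carrier L" "z \<in> carrier L"
  shows "(\<beta> x \<bullet> \<alpha> y) \<bullet> \<alpha> (\<alpha> z) = (\<beta> y \<bullet> \<alpha> z) \<bullet> \<alpha> (\<alpha> x)"
proof -
  obtain w where w: "w \<in> carrier L" "z = \<beta> w"
    using assms(3) by (rule \<beta>_surj)
  note [simp] = operations_closed assms w(1) comm.\<alpha>_\<beta>_commute
  have "(\<beta> x \<bullet> \<alpha> y) \<bullet> \<alpha> (\<alpha> z) = (\<beta> x \<bullet> \<alpha> y) \<bullet> \<beta> (\<alpha> (\<alpha> w))"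
    using w(2) by simp
  also have "\<dots> = \<alpha> (\<beta> x) \<bullet> (\<alpha> y \<bullet> \<alpha> (\<alpha> w))"
    by (rule comm.bihom_assoc[symmetric]) simp_all
  also have "\<dots> = \<beta> (\<alpha> x) \<bullet> \<alpha> (y \<bullet> \<alpha> w)"
    by (simp add: comm.\<alpha>_prd)
  also have "\<dots> = \<beta> (y \<bullet> \<alpha> w) \<bullet> \<alpha> (\<alpha> x)"
    by (rule comm.bihom_comm) simp_all
  also have "\<dots> = (\<beta> y \<bullet> \<alpha> z) \<bullet> \<alpha> (\<alpha> x)"
    using w(2) by (simp add: comm.\<beta>_prd)
  finally show ?thesis .
qed

text \<open>
  The twisted form of \<open>[x y, z] = [y, z] x - [z, x] y\<close>. The axiom expands brackets whose second
  argument is a product, so the bracket is first turned around by skew-symmetry, for which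
  surjectivity of \<open>\<beta>\<close> exhibits \<open>\<beta> x \<bullet> \<alpha> y\<close> as a value of \<open>\<beta>\<close>.
\<close>

lemma br_prd:
  assumes "x \<in> carrier L" "y \<in> carrier L" "z \<in> carrier L"
  shows "br (\<beta> x \<bullet> \<alpha> y) (\<alpha> (\<alpha> z))
    = (br (\<beta> y) (\<alpha> z) \<bullet> \<alpha> (\<alpha> x)) \<ominus>\<^bsub>L\<^esub> (br (\<beta> z) (\<alpha> x) \<bullet> \<alpha> (\<alpha> y))"
proof -
  obtain w where w: "w \<in> carrier L" "y = \<beta> w"
    using assms(2) by (rule \<beta>_surj)
  note [simp] = operations_closed assms w(1)
  have "br (\<beta> x \<bullet> \<alpha> y) (\<alpha> (\<alpha> z)) = br (\<beta> (x \<bullet> \<alpha> w)) (\<alpha> (\<alpha> z))"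
    by (simp add: w(2) comm.\<beta>_prd comm.\<alpha>_\<beta>_commute)
  also have "\<dots> = \<ominus>\<^bsub>L\<^esub> br (\<beta> (\<alpha> z)) (\<alpha> (x \<bullet> \<alpha> w))"
    by (rule Lie.bihom_skew_symmetric) simp_all
  also have "br (\<beta> (\<alpha> z)) (\<alpha> (x \<bullet> \<alpha> w)) = br (\<alpha> (\<beta> z)) (\<alpha> x \<bullet> \<alpha> (\<alpha> w))"
    by (simp add: comm.\<alpha>_prd comm.\<alpha>_\<beta>_commute)
  also have "\<dots> = (br (\<beta> z) (\<alpha> x) \<bullet> \<beta> (\<alpha> (\<alpha> w))) \<oplus>\<^bsub>L\<^esub> (\<beta> (\<alpha> x) \<bullet> br (\<alpha> z) (\<alpha> (\<alpha> w)))"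
    by (rule bihom_Leibniz) simp_all
  also have "\<beta> (\<alpha> (\<alpha> w)) = \<alpha> (\<alpha> y)"
    by (simp add: w(2) comm.\<alpha>_\<beta>_commute)
  also have "\<beta> (\<alpha> x) \<bullet> br (\<alpha> z) (\<alpha> (\<alpha> w)) = \<beta> (\<alpha> x) \<bullet> \<alpha> (br z (\<alpha> w))"
    by (simp add: Lie.\<alpha>_br)
  also have "\<dots> = \<beta> (br z (\<alpha> w)) \<bullet> \<alpha> (\<alpha> x)"
    by (rule comm.bihom_comm) simp_all
  also have "\<beta> (br z (\<alpha> w)) = br (\<beta> z) (\<alpha> y)"
    by (simp add: w(2) Lie.\<beta>_br comm.\<alpha>_\<beta>_commute)
  also have "\<dots> = \<ominus>\<^bsub>L\<^esub> br (\<beta> y) (\<alpha> z)"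
    by (rule Lie.bihom_skew_symmetric) simp_all
  finally show ?thesis
    by (simp add: prd_uminus_left comm.M.minus_add comm.M.a_comm comm.M.minus_eq)
qed

end

text \<open>
  In the Jacobi sum on the tensor product, \<open>j\<close> and \<open>k\<close> are the terms that involve only one of the
  two Jacobi identities, and the differences are the mixed terms.
\<close>

lemma (in abelian_group) cyclic_differences_cancel:
  assumes "s \<in> carrier G" "t \<in> carrier G" "u \<in> carrier G"
    "j1 \<in> carrier G" "j2 \<in> carrier G" "j3 \<in> carrier G"
    "k1 \<in> carrier G" "k2 \<in> carrier G" "k3 \<in> carrier G"
  shows "(j1 \<oplus> (s \<ominus> t) \<oplus> k1) \<oplus> (j2 \<oplus> (u \<ominus> s) \<oplus> k2)
      \<oplus> (j3 \<oplus> (t \<ominus> u) \<oplus> k3)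
    = (j1 \<oplus> j2 \<oplus> j3) \<oplus> (k1 \<oplus> k2 \<oplus> k3)"
proof -
  have "(s \<ominus> t) \<oplus> ((u \<ominus> s) \<oplus> (t \<ominus> u)) = \<zero>"
  proof -
    have "(s \<ominus> t) \<oplus> ((u \<ominus> s) \<oplus> (t \<ominus> u))
        = (s \<oplus> \<ominus> s) \<oplus> ((t \<oplus> \<ominus> t) \<oplus> (u \<oplus> \<ominus> u))"
      using assms unfolding minus_eq by (simp del: add.r_inv add: a_ac)
    then show ?thesis
      using assms by (simp add: r_neg)
  qed
  moreover have "(j1 \<oplus> (s \<ominus> t) \<oplus> k1) \<oplus> (j2 \<oplus> (u \<ominus> s) \<oplus> k2)
      \<oplus> (j3 \<oplus> (t \<ominus> u) \<oplus> k3)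
    = ((s \<ominus> t) \<oplus> ((u \<ominus> s) \<oplus> (t \<ominus> u)))
      \<oplus> ((j1 \<oplus> j2 \<oplus> j3) \<oplus> (k1 \<oplus> k2 \<oplus> k3))"
    using assms by (simp add: a_ac)
  ultimately show ?thesis
    using assms by simp
qed


section \<open>The tensor product of two regular BiHom-Poisson algebras\<close>

locale tensor_bihom_Poisson =
  A: regular_bihom_Poisson_algebra K A prdA brA \<alpha>A \<beta>A +
  B: regular_bihom_Poisson_algebra K B prdB brB \<alpha>B \<beta>B
  for K :: "('k, 'r) ring_scheme" and A :: "('k, 'a, 'm) module_scheme"
    and B :: "('k, 'b, 'n) module_scheme"
    and prdA (infixl \<open>\<bullet>\<^sub>A\<close> 70) and brA \<alpha>A \<beta>A
    and prdB (infixl \<open>\<bullet>\<^sub>B\<close> 70) and brB \<alpha>B \<beta>B +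
  fixes prd (infixl \<open>\<bullet>\<close> 70) and br \<alpha> \<beta>
  assumes prd_op: "is_tensor_product_op K A B prdA prdB prd"
    and br_op: "is_tensor_bracket_op K A B prdA brA prdB brB br"
    and \<alpha>_map: "is_tensor_map K A B \<alpha>A \<alpha>B \<alpha>"
    and \<beta>_map: "is_tensor_map K A B \<beta>A \<beta>B \<beta>"
begin

sublocale tensor_factors K A B
  by (intro tensor_factors.intro A.comm.module_axioms B.comm.module_axioms)

lemma prd_bilinear: "bilinear_map K T T T prd"
  and br_bilinear: "bilinear_map K T T T br"
  and \<alpha>_linear: "linear_map K T T \<alpha>"
  and \<beta>_linear: "linear_map K T T \<beta>"
  using prd_op br_op \<alpha>_map \<beta>_map
  by (simp_all add: is_tensor_product_op_def is_tensor_bracket_op_def is_tensor_map_def)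

lemma operations_tens:
  assumes "a \<in> carrier A" "b \<in> carrier B"
  shows "\<alpha> (tens a b) = tens (\<alpha>A a) (\<alpha>B b)" "\<beta> (tens a b) = tens (\<beta>A a) (\<beta>B b)"
    and "\<lbrakk>a' \<in> carrier A; b' \<in> carrier B\<rbrakk>
      \<Longrightarrow> tens a b \<bullet> tens a' b' = tens (a \<bullet>\<^sub>A a') (b \<bullet>\<^sub>B b')"
    and "\<lbrakk>a' \<in> carrier A; b' \<in> carrier B\<rbrakk>
      \<Longrightarrow> br (tens a b) (tens a' b') = tens (brA a a') (b \<bullet>\<^sub>B b') \<oplus>\<^bsub>T\<^esub> tens (a \<bullet>\<^sub>A a') (brB b b')"
  using prd_op br_op \<alpha>_map \<beta>_map assms
  by (simp_all add: is_tensor_product_op_def is_tensor_bracket_op_def is_tensor_map_def)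

lemmas factors_closed = A.operations_closed B.operations_closed

lemmas operations_closed =
  linear_mapD(1)[OF \<alpha>_linear] linear_mapD(1)[OF \<beta>_linear]
  bilinear_map_simps(1)[OF prd_bilinear] bilinear_map_simps(1)[OF br_bilinear]

text \<open>
  Used as introduction rules, these facts show that a composite expression is linear in a variable
  that occurs once in each summand; this is what reduces the axioms to pure tensors.
\<close>

lemma linear_map_in_operand:
  assumes "linear_map K T T f"
  shows "linear_map K T T (\<lambda>x. \<alpha> (f x))" "linear_map K T T (\<lambda>x. \<beta> (f x))"
    and "y \<in> carrier T \<Longrightarrow> linear_map K T T (\<lambda>x. f x \<bullet> y)"
    and "y \<in> carrier T \<Longrightarrow> linear_map K T T (\<lambda>x. y \<bullet> f x)"
    and "y \<in> carrier T \<Longrightarrow> linear_map K T T (\<lambda>x. br (f x) y)"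
    and "y \<in> carrier T \<Longrightarrow> linear_map K T T (\<lambda>x. br y (f x))"
  by (rule linear_map_compose[OF _ assms],
      rule \<alpha>_linear \<beta>_linear bilinear_mapD[OF prd_bilinear] bilinear_mapD[OF br_bilinear],
      assumption?)+

lemmas linear_intros =
  linear_map_in_operand linear_map_add[OF tensor_space_module]
  linear_map_uminus_fun[OF tensor_space_module] linear_map_zero[OF tensor_space_module]
  linear_map_id bilinear_mapI operations_closed T.a_closed

lemmas tens_expand = tens_simps bilinear_map_simps(2,3)[OF prd_bilinear]
  bilinear_map_simps(2,3)[OF br_bilinear] linear_mapD(2)[OF \<alpha>_linear] linear_mapD(2)[OF \<beta>_linear]
  operations_tens factors_closed

lemma tens_uminus:
  assumes "a \<in> carrier A" "b \<in> carrier B"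
  shows "tens (\<ominus>\<^bsub>A\<^esub> a) b = \<ominus>\<^bsub>T\<^esub> tens a b" "tens a (\<ominus>\<^bsub>B\<^esub> b) = \<ominus>\<^bsub>T\<^esub> tens a b"
  using linear_map_uminus[OF bilinear_mapD(2)[OF pure_tensor_bilinear assms(2)]
      A.comm.module_axioms tensor_space_module assms(1)]
    linear_map_uminus[OF bilinear_mapD(1)[OF pure_tensor_bilinear assms(1)]
      B.comm.module_axioms tensor_space_module assms(2)]
  by simp_all

lemma tens_zero:
  "b \<in> carrier B \<Longrightarrow> tens \<zero>\<^bsub>A\<^esub> b = \<zero>\<^bsub>T\<^esub>" "a \<in> carrier A \<Longrightarrow> tens a \<zero>\<^bsub>B\<^esub> = \<zero>\<^bsub>T\<^esub>"
  using tens_simps(4)[of "\<zero>\<^bsub>K\<^esub>" "\<zero>\<^bsub>A\<^esub>" b] tens_simps(5)[of "\<zero>\<^bsub>K\<^esub>" a "\<zero>\<^bsub>B\<^esub>"]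
  by (simp_all add: tens_simps(1))

lemma tensor_commutative_algebra: "bihom_commutative_algebra K T prd \<alpha> \<beta>"
proof (intro bihom_commutative_algebra.intro bihom_commutative_algebra_axioms.intro
    A.comm.field_axioms tensor_space_module prd_bilinear \<alpha>_linear \<beta>_linear)
  fix x assume "x \<in> carrier T"
  then show "\<alpha> (\<beta> x) = \<beta> (\<alpha> x)"
    by (rule tensor_linear_eqI[where f = "\<lambda>x. \<alpha> (\<beta> x)" and g = "\<lambda>x. \<beta> (\<alpha> x)", rotated 3])
      (auto intro!: linear_intros simp: tens_expand A.comm.\<alpha>_\<beta>_commute B.comm.\<alpha>_\<beta>_commute)
next
  fix x y assume xy: "x \<in> carrier T" "y \<in> carrier T"
  show "\<alpha> (x \<bullet> y) = \<alpha> x \<bullet> \<alpha> y"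
    using xy
    by (rule tensor_bilinear_eqI[where f = "\<lambda>x y. \<alpha> (x \<bullet> y)" and g = "\<lambda>x y. \<alpha> x \<bullet> \<alpha> y", rotated 3])
      (auto intro!: linear_intros simp: tens_expand A.comm.\<alpha>_prd B.comm.\<alpha>_prd)
  show "\<beta> (x \<bullet> y) = \<beta> x \<bullet> \<beta> y"
    using xy
    by (rule tensor_bilinear_eqI[where f = "\<lambda>x y. \<beta> (x \<bullet> y)" and g = "\<lambda>x y. \<beta> x \<bullet> \<beta> y", rotated 3])
      (auto intro!: linear_intros simp: tens_expand A.comm.\<beta>_prd B.comm.\<beta>_prd)
  show "\<beta> x \<bullet> \<alpha> y = \<beta> y \<bullet> \<alpha> x"
    using xy
    by (rule tensor_bilinear_eqI[where f = "\<lambda>x y. \<beta> x \<bullet> \<alpha> y" and g = "\<lambda>x y. \<beta> y \<bullet> \<alpha> x", rotated 3])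
      (auto intro!: linear_intros
        simp: tens_expand A.comm.bihom_comm[of _ a' for a'] B.comm.bihom_comm[of _ b' for b'])
next
  fix x y z assume "x \<in> carrier T" "y \<in> carrier T" "z \<in> carrier T"
  then show "\<alpha> x \<bullet> (y \<bullet> z) = (x \<bullet> y) \<bullet> \<beta> z"
    by (rule tensor_trilinear_eqI[where f = "\<lambda>x y z. \<alpha> x \<bullet> (y \<bullet> z)"
          and g = "\<lambda>x y z. (x \<bullet> y) \<bullet> \<beta> z", rotated 5])
      (auto intro!: linear_intros simp: tens_expand A.comm.bihom_assoc B.comm.bihom_assoc)
qed

text \<open>
  The three kinds of threefold expressions that a nested bracket of pure tensors produces in each
  factor: bracket in bracket (\<open>J\<close>), bracket in product (\<open>D\<close>), and product in product (\<open>M\<close>).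
\<close>

abbreviation "JA x y z \<equiv> brA (brA (\<beta>A x) (\<alpha>A y)) (\<alpha>A (\<alpha>A z))"
abbreviation "DA x y z \<equiv> brA (\<beta>A x) (\<alpha>A y) \<bullet>\<^sub>A \<alpha>A (\<alpha>A z)"
abbreviation "MA x y z \<equiv> (\<beta>A x \<bullet>\<^sub>A \<alpha>A y) \<bullet>\<^sub>A \<alpha>A (\<alpha>A z)"
abbreviation "JB x y z \<equiv> brB (brB (\<beta>B x) (\<alpha>B y)) (\<alpha>B (\<alpha>B z))"
abbreviation "DB x y z \<equiv> brB (\<beta>B x) (\<alpha>B y) \<bullet>\<^sub>B \<alpha>B (\<alpha>B z)"
abbreviation "MB x y z \<equiv> (\<beta>B x \<bullet>\<^sub>B \<alpha>B y) \<bullet>\<^sub>B \<alpha>B (\<alpha>B z)"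

text \<open>
  Expanding both brackets gives four terms. In the two mixed ones, a bracket in one factor stands
  against a bracket of a product in the other, which \<open>br_prd\<close> splits into two. They are grouped here
  as a difference of two sums, such that permuting the three arguments cyclically turns the second
  sum into the first one.
\<close>

lemma nested_bracket_tens:
  assumes ab: "a \<in> carrier A" "b \<in> carrier A" "c \<in> carrier A"
    "a' \<in> carrier B" "b' \<in> carrier B" "c' \<in> carrier B"
  shows "br (br (\<beta> (tens a a')) (\<alpha> (tens b b'))) (\<alpha> (\<alpha> (tens c c'))) =
    tens (JA a b c) (MB a' b' c') \<oplus>\<^bsub>T\<^esub>
    ((tens (DA a b c) (DB b' c' a') \<oplus>\<^bsub>T\<^esub> tens (DA b c a) (DB a' b' c')) \<ominus>\<^bsub>T\<^esub>
     (tens (DA c a b) (DB a' b' c') \<oplus>\<^bsub>T\<^esub> tens (DA a b c) (DB c' a' b'))) \<oplus>\<^bsub>T\<^esub>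
    tens (MA a b c) (JB a' b' c')"
  using ab
  by (simp add: tens_expand A.br_prd B.br_prd A.comm.M.minus_eq B.comm.M.minus_eq T.M.minus_eq
      tens_uminus T.M.minus_add T.M.a_ac)

text \<open>
  The mixed terms of the cyclic sum telescope. What is left is the Jacobi sum of \<open>A\<close> tensored with
  a product in \<open>B\<close> that does not depend on the cyclic order, and symmetrically.
\<close>

lemma Jacobi_tens:
  assumes ab: "a \<in> carrier A" "b \<in> carrier A" "c \<in> carrier A"
    "a' \<in> carrier B" "b' \<in> carrier B" "c' \<in> carrier B"
  defines "x \<equiv> tens a a'" and "y \<equiv> tens b b'" and "z \<equiv> tens c c'"
  shows "br (br (\<beta> x) (\<alpha> y)) (\<alpha> (\<alpha> z)) \<oplus>\<^bsub>T\<^esub> br (br (\<beta> y) (\<alpha> z)) (\<alpha> (\<alpha> x))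
    \<oplus>\<^bsub>T\<^esub> br (br (\<beta> z) (\<alpha> x)) (\<alpha> (\<alpha> y)) = \<zero>\<^bsub>T\<^esub>"
proof -
  have MA: "MA b c a = MA a b c" "MA c a b = MA a b c"
    using A.prd_cyclic[OF ab(1-3)] A.prd_cyclic[OF ab(2,3,1)] by simp_all
  have MB: "MB b' c' a' = MB a' b' c'" "MB c' a' b' = MB a' b' c'"
    using B.prd_cyclic[OF ab(4-6)] B.prd_cyclic[OF ab(5,6,4)] by simp_all
  have "br (br (\<beta> x) (\<alpha> y)) (\<alpha> (\<alpha> z)) \<oplus>\<^bsub>T\<^esub> br (br (\<beta> y) (\<alpha> z)) (\<alpha> (\<alpha> x))
      \<oplus>\<^bsub>T\<^esub> br (br (\<beta> z) (\<alpha> x)) (\<alpha> (\<alpha> y))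
    = (tens (JA a b c) (MB a' b' c') \<oplus>\<^bsub>T\<^esub> tens (JA b c a) (MB a' b' c')
        \<oplus>\<^bsub>T\<^esub> tens (JA c a b) (MB a' b' c'))
      \<oplus>\<^bsub>T\<^esub> (tens (MA a b c) (JB a' b' c') \<oplus>\<^bsub>T\<^esub> tens (MA a b c) (JB b' c' a')
        \<oplus>\<^bsub>T\<^esub> tens (MA a b c) (JB c' a' b'))"
    unfolding x_def y_def z_def nested_bracket_tens[OF ab]
      nested_bracket_tens[OF ab(2,3,1) ab(5,6,4)] nested_bracket_tens[OF ab(3,1,2) ab(6,4,5)] MA MB
    by (rule T.cyclic_differences_cancel; (intro T.a_closed tens_simps(1) factors_closed ab)?)
  also have "\<dots> = tens (JA a b c \<oplus>\<^bsub>A\<^esub> JA b c a \<oplus>\<^bsub>A\<^esub> JA c a b) (MB a' b' c')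
      \<oplus>\<^bsub>T\<^esub> tens (MA a b c) (JB a' b' c' \<oplus>\<^bsub>B\<^esub> JB b' c' a' \<oplus>\<^bsub>B\<^esub> JB c' a' b')"
    using ab by (simp add: tens_simps factors_closed)
  also have "\<dots> = \<zero>\<^bsub>T\<^esub>"
    using ab by (simp add: A.Lie.bihom_Jacobi B.Lie.bihom_Jacobi tens_zero factors_closed)
  finally show ?thesis .
qed

lemma tensor_Lie_algebra: "bihom_Lie_algebra K T br \<alpha> \<beta>"
proof (intro bihom_Lie_algebra.intro bihom_Lie_algebra_axioms.intro
    A.comm.field_axioms tensor_space_module br_bilinear \<alpha>_linear \<beta>_linear)
  show "\<alpha> (\<beta> x) = \<beta> (\<alpha> x)" if "x \<in> carrier T" for x
    using bihom_commutative_algebra.\<alpha>_\<beta>_commute[OF tensor_commutative_algebra that] .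
next
  fix x y assume xy: "x \<in> carrier T" "y \<in> carrier T"
  show "\<alpha> (br x y) = br (\<alpha> x) (\<alpha> y)"
    using xy
    by (rule tensor_bilinear_eqI[where f = "\<lambda>x y. \<alpha> (br x y)" and g = "\<lambda>x y. br (\<alpha> x) (\<alpha> y)", rotated 3])
      (auto intro!: linear_intros simp: tens_expand A.comm.\<alpha>_prd B.comm.\<alpha>_prd A.Lie.\<alpha>_br B.Lie.\<alpha>_br)
  show "\<beta> (br x y) = br (\<beta> x) (\<beta> y)"
    using xy
    by (rule tensor_bilinear_eqI[where f = "\<lambda>x y. \<beta> (br x y)" and g = "\<lambda>x y. br (\<beta> x) (\<beta> y)", rotated 3])
      (auto intro!: linear_intros simp: tens_expand A.comm.\<beta>_prd B.comm.\<beta>_prd A.Lie.\<beta>_br B.Lie.\<beta>_br)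
  show "br (\<beta> x) (\<alpha> y) = \<ominus>\<^bsub>T\<^esub> br (\<beta> y) (\<alpha> x)"
  proof (rule tensor_bilinear_eqI[where f = "\<lambda>x y. br (\<beta> x) (\<alpha> y)"
        and g = "\<lambda>x y. \<ominus>\<^bsub>T\<^esub> br (\<beta> y) (\<alpha> x)", OF _ _ _ xy])
    fix a a' b b' assume ab: "a \<in> carrier A" "a' \<in> carrier A" "b \<in> carrier B" "b' \<in> carrier B"
    show "br (\<beta> (tens a b)) (\<alpha> (tens a' b')) = \<ominus>\<^bsub>T\<^esub> br (\<beta> (tens a' b')) (\<alpha> (tens a b))"
      using ab A.Lie.bihom_skew_symmetric[OF ab(1,2)] B.Lie.bihom_skew_symmetric[OF ab(3,4)]
        A.comm.bihom_comm[OF ab(1,2)] B.comm.bihom_comm[OF ab(3,4)]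
      by (simp add: tens_expand tens_uminus T.M.minus_add)
  qed (auto intro!: linear_intros)
next
  fix x y z assume xyz: "x \<in> carrier T" "y \<in> carrier T" "z \<in> carrier T"
  show "br (br (\<beta> x) (\<alpha> y)) (\<alpha> (\<alpha> z)) \<oplus>\<^bsub>T\<^esub> br (br (\<beta> y) (\<alpha> z)) (\<alpha> (\<alpha> x))
    \<oplus>\<^bsub>T\<^esub> br (br (\<beta> z) (\<alpha> x)) (\<alpha> (\<alpha> y)) = \<zero>\<^bsub>T\<^esub>"
    by (rule tensor_trilinear_eqI[where g = "\<lambda>x y z. \<zero>\<^bsub>T\<^esub>" and
          f = "\<lambda>x y z. br (br (\<beta> x) (\<alpha> y)) (\<alpha> (\<alpha> z)) \<oplus>\<^bsub>T\<^esub> br (br (\<beta> y) (\<alpha> z)) (\<alpha> (\<alpha> x))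
             \<oplus>\<^bsub>T\<^esub> br (br (\<beta> z) (\<alpha> x)) (\<alpha> (\<alpha> y))", OF _ _ _ _ Jacobi_tens xyz])
      (auto intro!: linear_intros)
qed

text \<open>
  The Leibniz rule in one factor splits the bracket, and the product in the other factor has to be
  rewritten to match each of the two parts: for the first part by associativity, for the second by
  \<open>prd_left_commute\<close>.
\<close>

lemma Leibniz_tens:
  assumes ab: "a \<in> carrier A" "b \<in> carrier A" "c \<in> carrier A"
    "a' \<in> carrier B" "b' \<in> carrier B" "c' \<in> carrier B"
  defines "x \<equiv> tens a a'" and "y \<equiv> tens b b'" and "z \<equiv> tens c c'"
  shows "br (\<alpha> (\<beta> x)) (y \<bullet> z) = (br (\<beta> x) y \<bullet> \<beta> z) \<oplus>\<^bsub>T\<^esub> (\<beta> y \<bullet> br (\<alpha> x) z)"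
proof -
  let ?dA = "brA (\<beta>A a) b \<bullet>\<^sub>A \<beta>A c" and ?dA' = "\<beta>A b \<bullet>\<^sub>A brA (\<alpha>A a) c"
  let ?dB = "brB (\<beta>B a') b' \<bullet>\<^sub>B \<beta>B c'" and ?dB' = "\<beta>B b' \<bullet>\<^sub>B brB (\<alpha>B a') c'"
  have "br (\<alpha> (\<beta> x)) (y \<bullet> z)
      = tens (brA (\<alpha>A (\<beta>A a)) (b \<bullet>\<^sub>A c)) (\<alpha>B (\<beta>B a') \<bullet>\<^sub>B (b' \<bullet>\<^sub>B c'))
        \<oplus>\<^bsub>T\<^esub> tens (\<alpha>A (\<beta>A a) \<bullet>\<^sub>A (b \<bullet>\<^sub>A c)) (brB (\<alpha>B (\<beta>B a')) (b' \<bullet>\<^sub>B c'))"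
    using ab unfolding x_def y_def z_def by (simp add: tens_expand)
  also have "\<dots> = (tens ?dA (\<alpha>B (\<beta>B a') \<bullet>\<^sub>B (b' \<bullet>\<^sub>B c')) \<oplus>\<^bsub>T\<^esub> tens ?dA' (\<alpha>B (\<beta>B a') \<bullet>\<^sub>B (b' \<bullet>\<^sub>B c')))
        \<oplus>\<^bsub>T\<^esub> (tens (\<alpha>A (\<beta>A a) \<bullet>\<^sub>A (b \<bullet>\<^sub>A c)) ?dB \<oplus>\<^bsub>T\<^esub> tens (\<alpha>A (\<beta>A a) \<bullet>\<^sub>A (b \<bullet>\<^sub>A c)) ?dB')"
    using ab by (simp add: A.bihom_Leibniz B.bihom_Leibniz tens_simps factors_closed)
  also have "\<dots> = (tens ?dA ((\<beta>B a' \<bullet>\<^sub>B b') \<bullet>\<^sub>B \<beta>B c') \<oplus>\<^bsub>T\<^esub> tens ?dA' (\<beta>B b' \<bullet>\<^sub>B (\<alpha>B a' \<bullet>\<^sub>B c')))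
        \<oplus>\<^bsub>T\<^esub> (tens ((\<beta>A a \<bullet>\<^sub>A b) \<bullet>\<^sub>A \<beta>A c) ?dB \<oplus>\<^bsub>T\<^esub> tens (\<beta>A b \<bullet>\<^sub>A (\<alpha>A a \<bullet>\<^sub>A c)) ?dB')"
    using ab A.prd_left_commute[OF ab(1-3)] B.prd_left_commute[OF ab(4-6)]
      A.comm.bihom_assoc[of "\<beta>A a" b c] B.comm.bihom_assoc[of "\<beta>B a'" b' c']
    by (simp add: factors_closed)
  also have "\<dots> = (tens ?dA ((\<beta>B a' \<bullet>\<^sub>B b') \<bullet>\<^sub>B \<beta>B c') \<oplus>\<^bsub>T\<^esub> tens ((\<beta>A a \<bullet>\<^sub>A b) \<bullet>\<^sub>A \<beta>A c) ?dB)
        \<oplus>\<^bsub>T\<^esub> (tens ?dA' (\<beta>B b' \<bullet>\<^sub>B (\<alpha>B a' \<bullet>\<^sub>B c')) \<oplus>\<^bsub>T\<^esub> tens (\<beta>A b \<bullet>\<^sub>A (\<alpha>A a \<bullet>\<^sub>A c)) ?dB')"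
    using ab by (simp add: tens_simps factors_closed T.M.a_ac)
  also have "\<dots> = (br (\<beta> x) y \<bullet> \<beta> z) \<oplus>\<^bsub>T\<^esub> (\<beta> y \<bullet> br (\<alpha> x) z)"
    using ab unfolding x_def y_def z_def by (simp add: tens_expand)
  finally show ?thesis .
qed

lemma tensor_Poisson_algebra: "bihom_Poisson_algebra K T prd br \<alpha> \<beta>"
proof (intro bihom_Poisson_algebra.intro bihom_Poisson_algebra_axioms.intro
    tensor_commutative_algebra tensor_Lie_algebra)
  fix x y z assume xyz: "x \<in> carrier T" "y \<in> carrier T" "z \<in> carrier T"
  show "br (\<alpha> (\<beta> x)) (y \<bullet> z) = (br (\<beta> x) y \<bullet> \<beta> z) \<oplus>\<^bsub>T\<^esub> (\<beta> y \<bullet> br (\<alpha> x) z)"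
    by (rule tensor_trilinear_eqI[where f = "\<lambda>x y z. br (\<alpha> (\<beta> x)) (y \<bullet> z)" and
          g = "\<lambda>x y z. (br (\<beta> x) y \<bullet> \<beta> z) \<oplus>\<^bsub>T\<^esub> (\<beta> y \<bullet> br (\<alpha> x) z)", OF _ _ _ _ Leibniz_tens xyz])
      (auto intro!: linear_intros)
qed

end

theorem lemma2p10:
  fixes K :: "('k, 'r) ring_scheme"
    and A :: "('k, 'a, 'm) module_scheme"
    and B :: "('k, 'b, 'n) module_scheme"
    and prdA brA :: "'a \<Rightarrow> 'a \<Rightarrow> 'a" and \<alpha>A \<beta>A :: "'a \<Rightarrow> 'a"
    and prdB brB :: "'b \<Rightarrow> 'b \<Rightarrow> 'b" and \<alpha>B \<beta>B :: "'b \<Rightarrow> 'b"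
  assumes "field K"
    and char_0: "\<And>n::nat. 0 < n \<Longrightarrow> [n] \<cdot>\<^bsub>K\<^esub> \<one>\<^bsub>K\<^esub> \<noteq> \<zero>\<^bsub>K\<^esub>"
    and "regular_bihom_Poisson_algebra K A prdA brA \<alpha>A \<beta>A"
    and "regular_bihom_Poisson_algebra K B prdB brB \<alpha>B \<beta>B"
  shows "(\<exists>prd. is_tensor_product_op K A B prdA prdB prd) \<and>
    (\<exists>br. is_tensor_bracket_op K A B prdA brA prdB brB br) \<and>
    (\<exists>\<alpha>. is_tensor_map K A B \<alpha>A \<alpha>B \<alpha>) \<and>
    (\<exists>\<beta>. is_tensor_map K A B \<beta>A \<beta>B \<beta>) \<and>
    (\<forall>prd br \<alpha> \<beta>.
       is_tensor_product_op K A B prdA prdB prd \<longrightarrow>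
       is_tensor_bracket_op K A B prdA brA prdB brB br \<longrightarrow>
       is_tensor_map K A B \<alpha>A \<alpha>B \<alpha> \<longrightarrow>
       is_tensor_map K A B \<beta>A \<beta>B \<beta> \<longrightarrow>
       bihom_Poisson_algebra K (tensor_space K A B) prd br \<alpha> \<beta>)"
proof -
  interpret A: regular_bihom_Poisson_algebra K A prdA brA \<alpha>A \<beta>A by fact
  interpret B: regular_bihom_Poisson_algebra K B prdB brB \<alpha>B \<beta>B by fact
  interpret tensor_factors K A B
    by (intro tensor_factors.intro A.comm.module_axioms B.comm.module_axioms)
  have "bihom_Poisson_algebra K (tensor_space K A B) prd br \<alpha> \<beta>"
    if "is_tensor_product_op K A B prdA prdB prd"
      "is_tensor_bracket_op K A B prdA brA prdB brB br"
      "is_tensor_map K A B \<alpha>A \<alpha>B \<alpha>" "is_tensor_map K A B \<beta>A \<beta>B \<beta>" for prd br \<alpha> \<beta>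
    using tensor_bihom_Poisson.tensor_Poisson_algebra[OF tensor_bihom_Poisson.intro,
        OF assms(3,4) tensor_bihom_Poisson_axioms.intro, OF that] .
  then show ?thesis
    using tensor_product_op_exists[OF A.comm.prd_bilinear B.comm.prd_bilinear]
      tensor_bracket_op_exists[OF A.comm.prd_bilinear A.Lie.br_bilinear
        B.comm.prd_bilinear B.Lie.br_bilinear]
      tensor_map_exists[OF A.comm.\<alpha>_linear B.comm.\<alpha>_linear]
      tensor_map_exists[OF A.comm.\<beta>_linear B.comm.\<beta>_linear]
    by blast
qed

end
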